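(* Let $\alpha\in(0,1]$ and let $\mathbb I=(\mathcal M_1,\dots,\mathcal M_n,\mathcal F)$ be an instance of matroid-max-CICS such that each $\mathcal M_i$ admits an $\alpha$-local approximation under some commitment $\pi_i$ for $\mathcal M_i$. Then $\mathrm{CG}(\mathbb I)\ge\alpha$.
   Context: A costly information MDP is $\mathcal M=(S,\sigma,A,c,\mathcal D,V,T)$: a finite state set, start state $\sigma$, terminal states $T$, for each nonterminal $s$ a finite nonempty action set $A(s)$ with costs $c(a)\ge0$ and transition distributions $\mathcal D(s,a,\cdot)$; $v(s)$ is the conditional expected value of an underlying nonnegative random variable at state $s$. At a terminal state the only action is "accept" (cost $0$, yields value $v(t)$, ends the process). Acyclic, bounded horizon. Matroid-max-CICS: $n$ independent such MDPs and a matroid on $[n]$ with independent sets $\mathcal F$; a policy adaptively advances MDPs paying action costs, may accept a terminal state of $\mathcal M_i$ only if the accepted set stays in $\mathcal F$, and may stop anytime; utility = collected values minus costs; $\mathrm{OPT}(\mathbb I)$ = maximum expected utility. A commitment $\pi$ for $\mathcal M$ assigns each nonterminal state a distribution over its actions; $\mathcal M^\pi$ is the resulting Markov chain. For $\mathcal P=(\pi_1,\dots,\pi_n)$, $\mathbb I_{|\mathcal P}=(\mathcal M_1^{\pi_1},\dots,\mathcal M_n^{\pi_n},\mathcal F)$; $\mathrm{CG}(\mathbb I)=\max_{\mathcal P}\mathrm{OPT}(\mathbb I_{|\mathcal P})/\mathrm{OPT}(\mathbb I)$. For $y\in\mathbb R$, in the local game $(\mathcal M,y)$ a policy advances $\mathcal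 M$ and finally collects either an outside option of value $y$ or a terminal value of $\mathcal M$; $f_{\mathcal M}(y)$ is the maximum expected utility. A commitment $\pi$ is an $\alpha$-local approximation for $\mathcal M$ ($\alpha\in(0,1]$) if $f_{\mathcal M^\pi}(\alpha y)\ge\alpha f_{\mathcal M}(y)$ for all $y\in\mathbb R$. *)

theory Defs
  imports "HOL-Probability.Probability"
begin

text \<open>
  Costly information MDPs. The field \<open>law\<close> gives, for every state, the conditional distribution of
  the underlying nonnegative random variable given that the state has been reached; the value of a
  state is the mean of this distribution. Costs are attached to action names, as in \<open>c(a)\<close>.
  The accept action of terminal states is not listed in \<open>actions\<close>; it is part of the rules of the
  games below.
\<close>

record ('s, 'a) cimdp =
  states :: "'s set"
  start :: 's
  actions :: "'s \<Rightarrow> 'a set"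
  cost :: "'a \<Rightarrow> real"
  trans_pmf :: "'s \<Rightarrow> 'a \<Rightarrow> 's pmf"
  law :: "'s \<Rightarrow> real measure"
  terminals :: "'s set"

definition val :: "('s, 'a) cimdp \<Rightarrow> 's \<Rightarrow> real" where
  "val M s = (LINT x|law M s. x)"

definition nonterminals :: "('s, 'a) cimdp \<Rightarrow> 's set" where
  "nonterminals M = states M - terminals M"

definition step_rel :: "('s, 'a) cimdp \<Rightarrow> ('s \<times> 's) set" where
  "step_rel M = {(s, s'). s \<in> nonterminals M \<and> (\<exists>a\<in>actions M s. s' \<in> set_pmf (trans_pmf M s a))}"

text \<open>
  The last condition is the law of total probability: whichever action is taken, the conditional
  law at a state is the mixture of the conditional laws at its successors. Since the state set is
  finite, acyclicity bounds the horizon by the number of states.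
\<close>

definition costly_information_MDP :: "('s, 'a) cimdp \<Rightarrow> bool" where
  "costly_information_MDP M \<longleftrightarrow>
     finite (states M) \<and> start M \<in> states M \<and> terminals M \<subseteq> states M \<and>
     (\<forall>s\<in>nonterminals M. finite (actions M s) \<and> actions M s \<noteq> {}) \<and>
     (\<forall>s\<in>nonterminals M. \<forall>a\<in>actions M s. 0 \<le> cost M a) \<and>
     (\<forall>s\<in>nonterminals M. \<forall>a\<in>actions M s. set_pmf (trans_pmf M s a) \<subseteq> states M) \<and>
     acyclic (step_rel M) \<and>
     (\<forall>s\<in>states M. prob_space (law M s) \<and> sets (law M s) = sets borel \<and>
        (AE x in law M s. 0 \<le> x) \<and> integrable (law M s) (\<lambda>x. x)) \<and>
     (\<forall>s\<in>nonterminals M. \<forall>a\<in>actions M s. \<forall>B\<in>sets borel.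
        measure (law M s) B =
        measure_pmf.expectation (trans_pmf M s a) (\<lambda>s'. measure (law M s') B))"

definition matroid :: "'i set \<Rightarrow> 'i set set \<Rightarrow> bool" where
  "matroid E F \<longleftrightarrow>
     finite E \<and> F \<subseteq> Pow E \<and> {} \<in> F \<and>
     (\<forall>X Y. Y \<in> F \<and> X \<subseteq> Y \<longrightarrow> X \<in> F) \<and>
     (\<forall>X Y. X \<in> F \<and> Y \<in> F \<and> card X < card Y \<longrightarrow> (\<exists>e\<in>Y - X. insert e X \<in> F))"

definition matroid_max_CICS ::
    "nat \<Rightarrow> (nat \<Rightarrow> ('s, 'a) cimdp) \<Rightarrow> nat set set \<Rightarrow> bool" where
  "matroid_max_CICS n M F \<longleftrightarrow> (\<forall>i\<in>{1..n}. costly_information_MDP (M i)) \<and> matroid {1..n} F"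

text \<open>
  A policy is a decision tree whose branching on the observed successor states makes it adaptive
  (history dependent). In \<open>Advance i a k\<close>, action \<open>a\<close> of the \<open>i\<close>-th MDP is taken and play goes on
  with \<open>k s'\<close> if the new state is \<open>s'\<close>. \<open>Flip p\<close> randomises between two continuations with
  probabilities \<open>p\<close> and \<open>1 - p\<close>; as only finitely many moves are available at any time, nested
  flips express every randomised choice of the next move.
\<close>

datatype ('s, 'a) policy =
    Stop
  | Accept nat "('s, 'a) policy"
  | Advance nat 'a "'s \<Rightarrow> ('s, 'a) policy"
  | Flip real "('s, 'a) policy" "('s, 'a) policy"

text \<open>
  The position of the game is the vector \<open>x\<close> of current states together with the set \<open>X\<close> of
  accepted indices.
\<close>

primrec feasible :: "nat \<Rightarrow> (nat \<Rightarrow> ('s, 'a) cimdp) \<Rightarrow> nat set set \<Rightarrow>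
    ('s, 'a) policy \<Rightarrow> (nat \<Rightarrow> 's) \<Rightarrow> nat set \<Rightarrow> bool" where
  "feasible n M F Stop x X = True"
| "feasible n M F (Accept i p) x X =
     (i \<in> {1..n} \<and> x i \<in> terminals (M i) \<and> i \<notin> X \<and> insert i X \<in> F \<and>
      feasible n M F p x (insert i X))"
| "feasible n M F (Advance i a k) x X =
     (i \<in> {1..n} \<and> x i \<in> nonterminals (M i) \<and> a \<in> actions (M i) (x i) \<and>
      (\<forall>s'\<in>set_pmf (trans_pmf (M i) (x i) a). feasible n M F (k s') (x(i := s')) X))"
| "feasible n M F (Flip p q r) x X =
     (p \<in> {0..1} \<and> feasible n M F q x X \<and> feasible n M F r x X)"

primrec utility :: "(nat \<Rightarrow> ('s, 'a) cimdp) \<Rightarrow> ('s, 'a) policy \<Rightarrow> (nat \<Rightarrow> 's) \<Rightarrow> real" where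
  "utility M Stop x = 0"
| "utility M (Accept i p) x = val (M i) (x i) + utility M p x"
| "utility M (Advance i a k) x =
     - cost (M i) a +
     measure_pmf.expectation (trans_pmf (M i) (x i) a) (\<lambda>s'. utility M (k s') (x(i := s')))"
| "utility M (Flip p q r) x = p * utility M q x + (1 - p) * utility M r x"

definition OPT :: "nat \<Rightarrow> (nat \<Rightarrow> ('s, 'a) cimdp) \<Rightarrow> nat set set \<Rightarrow> real" where
  "OPT n M F = (SUP p\<in>{p. feasible n M F p (\<lambda>i. start (M i)) {}}. utility M p (\<lambda>i. start (M i)))"

definition commitment :: "('s, 'a) cimdp \<Rightarrow> ('s \<Rightarrow> 'a pmf) \<Rightarrow> bool" where
  "commitment M \<pi> \<longleftrightarrow> (\<forall>s\<in>nonterminals M. set_pmf (\<pi> s) \<subseteq> actions M s)"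

text \<open>
  The Markov chain induced by a commitment: a costly information MDP with one action in each
  nonterminal state. That action is named after the state, so that costs remain a function of the
  action.
\<close>

definition commit :: "('s, 'a) cimdp \<Rightarrow> ('s \<Rightarrow> 'a pmf) \<Rightarrow> ('s, 's) cimdp" where
  "commit M \<pi> =
     \<lparr>states = states M,
      start = start M,
      actions = (\<lambda>s. {s}),
      cost = (\<lambda>s. measure_pmf.expectation (\<pi> s) (cost M)),
      trans_pmf = (\<lambda>s _. bind_pmf (\<pi> s) (trans_pmf M s)),
      law = law M,
      terminals = terminals M\<rparr>"

text \<open>
  The ratio is read as 1 if \<open>OPT n M F = 0\<close>: then also every committed instance has optimum 0 and
  nothing is lost by committing.
\<close>

definition CG :: "nat \<Rightarrow> (nat \<Rightarrow> ('s, 'a) cimdp) \<Rightarrow> nat set set \<Rightarrow> real" where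
  "CG n M F =
     (SUP P\<in>{P. \<forall>i\<in>{1..n}. commitment (M i) (P i)}.
        if OPT n M F = 0 then 1 else OPT n (\<lambda>i. commit (M i) (P i)) F / OPT n M F)"

text \<open>
  Policies of the local game: exactly one of the outside option and a terminal value is collected
  in the end, also if the outside option is negative.
\<close>

datatype ('s, 'a) local_policy =
    Take_Outside
  | Take_Terminal
  | Local_Advance 'a "'s \<Rightarrow> ('s, 'a) local_policy"
  | Local_Flip real "('s, 'a) local_policy" "('s, 'a) local_policy"

primrec local_feasible :: "('s, 'a) cimdp \<Rightarrow> ('s, 'a) local_policy \<Rightarrow> 's \<Rightarrow> bool" where
  "local_feasible M Take_Outside s = True"
| "local_feasible M Take_Terminal s = (s \<in> terminals M)"
| "local_feasible M (Local_Advance a k) s =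
     (s \<in> nonterminals M \<and> a \<in> actions M s \<and>
      (\<forall>s'\<in>set_pmf (trans_pmf M s a). local_feasible M (k s') s'))"
| "local_feasible M (Local_Flip p q r) s =
     (p \<in> {0..1} \<and> local_feasible M q s \<and> local_feasible M r s)"

primrec local_utility :: "('s, 'a) cimdp \<Rightarrow> real \<Rightarrow> ('s, 'a) local_policy \<Rightarrow> 's \<Rightarrow> real" where
  "local_utility M y Take_Outside s = y"
| "local_utility M y Take_Terminal s = val M s"
| "local_utility M y (Local_Advance a k) s =
     - cost M a +
     measure_pmf.expectation (trans_pmf M s a) (\<lambda>s'. local_utility M y (k s') s')"
| "local_utility M y (Local_Flip p q r) s =
     p * local_utility M y q s + (1 - p) * local_utility M y r s"

definition local_opt :: "('s, 'a) cimdp \<Rightarrow> real \<Rightarrow> real" where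
  "local_opt M y = (SUP p\<in>{p. local_feasible M p (start M)}. local_utility M y p (start M))"

definition local_approximation :: "real \<Rightarrow> ('s, 'a) cimdp \<Rightarrow> ('s \<Rightarrow> 'a pmf) \<Rightarrow> bool" where
  "local_approximation \<alpha> M \<pi> \<longleftrightarrow>
     commitment M \<pi> \<and> (\<forall>y. local_opt (commit M \<pi>) (\<alpha> * y) \<ge> \<alpha> * local_opt M y)"

end

theory Submission
  imports Defs
begin

text \<open>
  Write \<open>f\<^sub>M y\<close> for the optimum of the local game. As a function of the outside option it is convex
  and piecewise linear, hence of the form \<open>y \<mapsto> E (max y W)\<close> for a finitely supported random prize
  \<open>W\<close>, and this applies to every state of \<open>M\<close>. Give all MDPs independent prizes belonging to their
  current states and let the potential of a position be the expected maximum weight of a set by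
  which the accepted set can be extended. As a function of a single prize \<open>w\<close> the maximum weight is
  \<open>B + max (A - B) w\<close>, so that an advance of one MDP changes the potential like a move in the local
  game with outside option \<open>A - B\<close>. Therefore no policy gains more than the potential.
  For Markov chains the potential is attained by moving the eligible chain whose prize has
  the largest maximum \<open>\<tau>\<close>: the exchange property gives \<open>A - B \<le> \<tau>\<close>, and for such outside options
  advancing is optimal in the local game. Finally, a local approximation says that the payoff
  functions of the prizes of the chains dominate those of the prizes of the MDPs scaled by \<open>\<alpha>\<close>;
  the expected maximum weight is monotone in every payoff function and homogeneous.
\<close>

section \<open>Finitely supported distributions\<close>

lemma expectation_bind_finite:
  fixes h :: "'b \<Rightarrow> real"
  assumes "finite (set_pmf p)" "\<And>x. x \<in> set_pmf p \<Longrightarrow> finite (set_pmf (f x))"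
  shows "measure_pmf.expectation (bind_pmf p f) h =
    measure_pmf.expectation p (\<lambda>x. measure_pmf.expectation (f x) h)"
  using pmf_expectation_bind[of "set_pmf p" f p h] assms
  by (simp add: integral_measure_pmf[OF assms(1)])

lemma expectation_mono_finite:
  fixes g h :: "'b \<Rightarrow> real"
  assumes "finite (set_pmf p)" "\<And>x. x \<in> set_pmf p \<Longrightarrow> g x \<le> h x"
  shows "measure_pmf.expectation p g \<le> measure_pmf.expectation p h"
  by (intro integral_mono_AE integrable_measure_pmf_finite assms)
     (auto simp: AE_measure_pmf_iff assms)

lemma expectation_cong_pmf:
  fixes g h :: "'b \<Rightarrow> real"
  assumes "\<And>x. x \<in> set_pmf p \<Longrightarrow> g x = h x"
  shows "measure_pmf.expectation p g = measure_pmf.expectation p h"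
  by (intro integral_cong_AE) (auto simp: AE_measure_pmf_iff assms)

lemma expectation_add_finite:
  fixes g h :: "'b \<Rightarrow> real"
  assumes "finite (set_pmf p)"
  shows "measure_pmf.expectation p (\<lambda>x. g x + h x) =
    measure_pmf.expectation p g + measure_pmf.expectation p h"
  by (intro Bochner_Integration.integral_add integrable_measure_pmf_finite assms)

lemma expectation_diff_finite:
  fixes g h :: "'b \<Rightarrow> real"
  assumes "finite (set_pmf p)"
  shows "measure_pmf.expectation p (\<lambda>x. g x - h x) =
    measure_pmf.expectation p g - measure_pmf.expectation p h"
  by (intro Bochner_Integration.integral_diff integrable_measure_pmf_finite assms)

text \<open>The value of the local game in which the prize is revealed for free.\<close>

definition payoff :: "real pmf \<Rightarrow> real \<Rightarrow> real" where
  "payoff \<mu> y = measure_pmf.expectation \<mu> (\<lambda>v. max y v)"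

lemma payoff_return [simp]: "payoff (return_pmf v) y = max y v"
  by (simp add: payoff_def)

lemma payoff_bind:
  assumes "finite (set_pmf p)" "\<And>x. x \<in> set_pmf p \<Longrightarrow> finite (set_pmf (f x))"
  shows "payoff (bind_pmf p f) y = measure_pmf.expectation p (\<lambda>x. payoff (f x) y)"
  unfolding payoff_def by (rule expectation_bind_finite[OF assms])

section \<open>Elementary properties of payoff functions\<close>

lemma payoff_ge: "finite (set_pmf \<mu>) \<Longrightarrow> y \<le> payoff \<mu> y"
  using expectation_mono_finite[of \<mu> "\<lambda>_. y" "\<lambda>v. max y v"] by (simp add: payoff_def)

lemma payoff_ge_mean:
  "finite (set_pmf \<mu>) \<Longrightarrow> measure_pmf.expectation \<mu> (\<lambda>v. v) \<le> payoff \<mu> y"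
  unfolding payoff_def by (rule expectation_mono_finite) auto

lemma payoff_sum:
  "finite (set_pmf \<mu>) \<Longrightarrow> payoff \<mu> y = (\<Sum>v\<in>set_pmf \<mu>. pmf \<mu> v * max y v)"
  unfolding payoff_def by (subst integral_measure_pmf[of "set_pmf \<mu>"]) auto

lemma continuous_on_payoff:
  assumes "finite (set_pmf \<mu>)" shows "continuous_on A (payoff \<mu>)"
  unfolding payoff_sum[OF assms, abs_def] by (intro continuous_intros)

text \<open>Each \<open>max y v\<close> is convex in \<open>y\<close>, and averaging over
  \<open>v\<close> keeps this. Convexity later confines the set where a line exceeds a payoff
  function to an interval.\<close>

lemma convex_on_payoff:
  assumes "finite (set_pmf \<mu>)" shows "convex_on UNIV (payoff \<mu>)"
proof (rule convex_onI)
  fix t x y :: real assume t: "0 < t" "t < 1"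
  have "payoff \<mu> ((1 - t) *\<^sub>R x + t *\<^sub>R y) \<le>
      measure_pmf.expectation \<mu> (\<lambda>v. (1 - t) * max x v + t * max y v)"
    unfolding payoff_def
  proof (rule expectation_mono_finite[OF assms])
    fix v :: real
    have "(1 - t) * x \<le> (1 - t) * max x v" "t * y \<le> t * max y v"
      "(1 - t) * v \<le> (1 - t) * max x v" "t * v \<le> t * max y v"
      using t by (auto intro!: mult_left_mono)
    then show "max ((1 - t) *\<^sub>R x + t *\<^sub>R y) v \<le> (1 - t) * max x v + t * max y v"
      by (simp add: left_diff_distrib)
  qed
  also have "\<dots> = (1 - t) * payoff \<mu> x + t * payoff \<mu> y"
    by (simp add: payoff_def expectation_add_finite[OF assms])
  finally show "payoff \<mu> ((1 - t) *\<^sub>R x + t *\<^sub>R y) \<le> (1 - t) * payoff \<mu> x + t * payoff \<mu> y" .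
qed simp

text \<open>The prize \<open>v\<close> beats the outside option with positive probability. Hence
  stopping is strictly suboptimal for every outside option below the largest prize.\<close>

lemma payoff_gt:
  assumes "finite (set_pmf \<mu>)" "v \<in> set_pmf \<mu>" "y < v"
  shows "y < payoff \<mu> y"
proof -
  have "0 < pmf \<mu> v * (v - y)" using assms by (simp add: pmf_positive)
  also have "\<dots> \<le> (\<Sum>u\<in>set_pmf \<mu>. pmf \<mu> u * (max y u - y))"
    using assms member_le_sum[of v "set_pmf \<mu>" "\<lambda>u. pmf \<mu> u * (max y u - y)"] by auto
  also have "\<dots> = payoff \<mu> y - y"
    using assms by (simp add: payoff_sum algebra_simps sum_subtractf sum_pmf_eq_1 flip: sum_distrib_left)
  finally show ?thesis by simp
qed

text \<open>Moving the mass of \<open>(u, v)\<close> to its end points without changing the mean replaces the payoff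
  on \<open>[u, v]\<close> by its chord and keeps it elsewhere.\<close>

definition spread :: "real \<Rightarrow> real \<Rightarrow> real \<Rightarrow> real pmf" where
  "spread u v w = (if u < w \<and> w < v
     then map_pmf (\<lambda>b. if b then v else u) (bernoulli_pmf ((w - u) / (v - u)))
     else return_pmf w)"

lemma finite_set_spread [simp]: "finite (set_pmf (spread u v w))"
  by (simp add: spread_def)

section \<open>Mean-preserving spreads and maxima of payoff functions with lines\<close>

lemma expectation_spread:
  assumes "u < w" "w < v"
  shows "measure_pmf.expectation (spread u v w) h =
     ((w - u) * h v + (v - w) * h u) / (v - u)"
proof -
  have "0 \<le> (w - u) / (v - u)" "(w - u) / (v - u) \<le> 1" "1 - (w - u) / (v - u) = (v - w) / (v - u)"
    using assms by (auto simp: field_simps)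
  then show ?thesis
    using assms by (simp add: spread_def) (simp add: add_divide_distrib mult.commute)
qed

text \<open>For \<open>y\<close> outside \<open>(u, v)\<close> the map \<open>max y\<close> is
  affine on \<open>[u, v]\<close>, and the spread preserves the mean.\<close>

lemma payoff_spread_outside:
  assumes "y \<le> u \<or> v \<le> y"
  shows "payoff (spread u v w) y = max y w"
proof (cases "u < w \<and> w < v")
  case True
  then have "((w - u) * max y v + (v - w) * max y u) / (v - u) = max y w"
    using assms by (auto simp: max_def field_simps)
  with True show ?thesis by (simp add: payoff_def expectation_spread)
qed (auto simp: spread_def)

text \<open>With no mass inside \<open>(u, v)\<close> the payoff is affine in \<open>y\<close> on
  \<open>[u, v]\<close>; its end values are those of the point mass at \<open>w\<close>.\<close>

lemma payoff_spread_inside: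
  assumes "u \<le> y" "y \<le> v" "u < v"
  shows "payoff (spread u v w) y = ((v - y) * max u w + (y - u) * max v w) / (v - u)"
proof (cases "u < w \<and> w < v")
  case True
  then have "((w - u) * max y v + (v - w) * max y u) / (v - u) =
     ((v - y) * max u w + (y - u) * max v w) / (v - u)"
    using assms by (auto simp: max_def field_simps)
  with True show ?thesis by (simp add: payoff_def expectation_spread)
next
  case False
  then have "payoff (spread u v w) y = max y w" by (auto simp: spread_def)
  moreover consider "w \<le> u" | "v \<le> w" using False by linarith
  then have "(v - y) * max u w + (y - u) * max v w = max y w * (v - u)"
  proof cases
    case 1
    then have "max u w = u" "max v w = v" "max y w = y" using assms by auto
    then show ?thesis by (simp add: algebra_simps)
  next
    case 2
    then have "max u w = w" "max v w = w" "max y w = w" using assms by auto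
    then show ?thesis by (simp add: algebra_simps)
  qed
  then have "((v - y) * max u w + (y - u) * max v w) / (v - u) = max y w"
    using assms by simp
  ultimately show ?thesis by simp
qed

text \<open>By convexity the line is at most the payoff function outside \<open>[u, v]\<close> and
  at least the payoff function inside, where the spread produces the chord, which is this
  line.\<close>

lemma max_payoff_line_spread:
  assumes fin: "finite (set_pmf \<mu>)" and uxv: "u < x" "x < v"
    and eq: "payoff \<mu> u = p * u + q" "payoff \<mu> v = p * v + q" and lt: "payoff \<mu> x < p * x + q"
  shows "payoff (bind_pmf \<mu> (spread u v)) y = max (payoff \<mu> y) (p * y + q)"
proof -
  let ?g = "\<lambda>y. p * y + q"
  have weights: "1 - (b - a) / (c - a) = (c - b) / (c - a)"
      "(c - b) / (c - a) * a + (b - a) / (c - a) * c = b"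
    if "a < b" "b < c" for a b c :: real
  proof -
    show "1 - (b - a) / (c - a) = (c - b) / (c - a)"
      using that by (simp add: field_simps)
    have "(c - b) / (c - a) * a + (b - a) / (c - a) * c = ((c - b) * a + (b - a) * c) / (c - a)"
      by (simp add: add_divide_distrib)
    also have "(c - b) * a + (b - a) * c = b * (c - a)" by (simp add: algebra_simps)
    finally show "(c - b) / (c - a) * a + (b - a) / (c - a) * c = b" using that by simp
  qed
  have cvx: "payoff \<mu> b \<le> (c - b) / (c - a) * payoff \<mu> a + (b - a) / (c - a) * payoff \<mu> c"
    if "a < b" "b < c" for a b c
    using convex_onD[OF convex_on_payoff[OF fin], of "(b - a) / (c - a)" a c] weights[OF that] that
    by simp
  have line: "?g b = (c - b) / (c - a) * ?g a + (b - a) / (c - a) * ?g c"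
    if "a < b" "b < c" for a b c
  proof -
    have "s * ?g a + t * ?g c = p * (s * a + t * c) + q * (s + t)" for s t
      by (simp add: algebra_simps)
    then have "(c - b) / (c - a) * ?g a + (b - a) / (c - a) * ?g c =
      p * ((c - b) / (c - a) * a + (b - a) / (c - a) * c) + q * ((c - b) / (c - a) + (b - a) / (c - a))"
      by blast
    also have "(c - b) / (c - a) + (b - a) / (c - a) = 1"
      using weights(1)[OF that] by linarith
    finally show ?thesis using weights(2)[OF that] by simp
  qed
  have bind: "payoff (bind_pmf \<mu> (spread u v)) y =
      measure_pmf.expectation \<mu> (\<lambda>w. payoff (spread u v w) y)"
    using fin by (simp add: payoff_bind)
  consider "y < u" | "v < y" | "u \<le> y" "y \<le> v" by linarith
  then show ?thesis
  proof cases
    case 1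
    \<comment> \<open>Were the line above the payoff function at \<open>y\<close> as well as at
      \<open>x\<close>, convexity would put the payoff function strictly below the line at
      \<open>u\<close>, where they agree.\<close>
    have "?g y \<le> payoff \<mu> y"
    proof (rule ccontr)
      assume "\<not> ?thesis"
      then have "(x - u) / (x - y) * payoff \<mu> y < (x - u) / (x - y) * ?g y"
         "(u - y) / (x - y) * payoff \<mu> x < (u - y) / (x - y) * ?g x"
        using lt 1 uxv
        by (auto intro!: mult_strict_left_mono divide_pos_pos
            simp del: times_divide_eq_left times_divide_eq_right)
      then show False using cvx[of y u x] line[of y u x] 1 uxv eq by linarith
    qed
    moreover have "payoff (bind_pmf \<mu> (spread u v)) y = payoff \<mu> y"
      using 1 bind by (simp add: payoff_spread_outside) (simp add: payoff_def)
    ultimately show ?thesis by simp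
  next
    case 2
    have "?g y \<le> payoff \<mu> y"
    proof (rule ccontr)
      assume "\<not> ?thesis"
      then have "(v - x) / (y - x) * payoff \<mu> y < (v - x) / (y - x) * ?g y"
         "(y - v) / (y - x) * payoff \<mu> x < (y - v) / (y - x) * ?g x"
        using lt 2 uxv
        by (auto intro!: mult_strict_left_mono divide_pos_pos
            simp del: times_divide_eq_left times_divide_eq_right)
      then show False using cvx[of x v y] line[of x v y] 2 uxv eq by linarith
    qed
    moreover have "payoff (bind_pmf \<mu> (spread u v)) y = payoff \<mu> y"
      using 2 bind by (simp add: payoff_spread_outside) (simp add: payoff_def)
    ultimately show ?thesis by simp
  next
    case 3
    have "measure_pmf.expectation \<mu> (\<lambda>w. payoff (spread u v w) y) =
       measure_pmf.expectation \<mu> (\<lambda>w. ((v - y) * max u w + (y - u) * max v w) / (v - u))"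
      using 3 uxv by (intro expectation_cong_pmf payoff_spread_inside) auto
    also have "\<dots> = ((v - y) * payoff \<mu> u + (y - u) * payoff \<mu> v) / (v - u)"
      using fin by (simp add: payoff_def expectation_add_finite)
    also have "\<dots> = ?g y" using uxv by (simp add: eq field_simps)
    finally have *: "payoff (bind_pmf \<mu> (spread u v)) y = ?g y" using bind by simp
    have "payoff \<mu> y \<le> ?g y"
      using cvx[of u y v] line[of u y v] 3 eq by (cases "u = y \<or> y = v") auto
    with * show ?thesis by simp
  qed
qed

text \<open>If the line exceeds the payoff function at all, it does so on an interval, whose end
  points the intermediate value theorem provides. A line with \<open>p = 1\<close> and
  \<open>q > 0\<close> is excluded, since the maximum would exceed \<open>y\<close> for all large
  \<open>y\<close>, unlike any payoff function of finitely many prizes.\<close>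

lemma ex_payoff_eq_max_line:
  assumes fin: "finite (set_pmf \<mu>)" and p: "0 \<le> p" "p \<le> 1" "p < 1 \<or> q \<le> 0"
  shows "\<exists>\<mu>'. finite (set_pmf \<mu>') \<and> (\<forall>y. payoff \<mu>' y = max (payoff \<mu> y) (p * y + q))"
proof (cases "\<forall>y. p * y + q \<le> payoff \<mu> y")
  case True
  then show ?thesis using fin by (intro exI[of _ \<mu>]) (simp add: max_absorb1)
next
  case False
  then obtain x where x: "payoff \<mu> x < p * x + q" by (auto simp: not_le)
  have p1: "p < 1"
    using x p payoff_ge[OF fin, of x] by (cases "p = 1") auto
  define m where "m = measure_pmf.expectation \<mu> (\<lambda>v. v)"
  have "\<exists>z>x. p * z + q \<le> payoff \<mu> z"
  proof -
    \<comment> \<open>From \<open>q / (1 - p)\<close> on the line is at most the identity, hence at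
      most the payoff function.\<close>
    let ?z = "max (x + 1) (q / (1 - p))"
    have "q / (1 - p) \<le> ?z" by simp
    then have "q \<le> ?z * (1 - p)" using p1 by (subst (asm) pos_divide_le_eq) auto
    then have "p * ?z + q \<le> ?z" by (simp add: algebra_simps)
    also have "\<dots> \<le> payoff \<mu> ?z" by (rule payoff_ge[OF fin])
    finally show ?thesis by (intro exI[of _ ?z]) auto
  qed
  then obtain z where z: "x < z" "p * z + q \<le> payoff \<mu> z" by auto
  have "\<exists>v\<ge>x. v \<le> z \<and> payoff \<mu> v - (p * v + q) = 0"
    using x z by (intro IVT' continuous_intros continuous_on_payoff fin) auto
  then obtain v where v: "x < v" "payoff \<mu> v = p * v + q"
    using x by (auto simp: le_less)
  show ?thesis
  proof (cases "p = 0")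
    case True
    \<comment> \<open>A horizontal line above the payoff function at \<open>x\<close> does not meet
      it further left, as the latter is monotone. Raising all prizes below \<open>v\<close> to
      \<open>v\<close> freezes the payoff function left of \<open>v\<close> at its value
      \<open>q\<close> there.\<close>
    let ?\<mu>' = "map_pmf (max v) \<mu>"
    have "payoff ?\<mu>' y = max (payoff \<mu> y) (p * y + q)" for y
    proof -
      have eq: "payoff ?\<mu>' y = payoff \<mu> (max y v)"
        by (simp add: payoff_def max.assoc)
      have mono: "payoff \<mu> a \<le> payoff \<mu> b" if "a \<le> b" for a b
        unfolding payoff_def using that by (intro expectation_mono_finite fin) auto
      show ?thesis
        using mono[of y v] mono[of v y] v(2) True by (cases "y \<le> v") (auto simp: eq max_def)
    qed
    then show ?thesis using fin by (intro exI[of _ ?\<mu>']) auto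
  next
    case False
    with p have p0: "0 < p" by simp
    have "\<exists>z<x. p * z + q \<le> payoff \<mu> z"
    proof -
      \<comment> \<open>Up to \<open>(m - q) / p\<close> the line is at most the mean
        \<open>m\<close>, a lower bound of the payoff function.\<close>
      let ?z = "min (x - 1) ((m - q) / p)"
      have "?z \<le> (m - q) / p" by simp
      then have "?z * p \<le> m - q" using p0 by (subst (asm) pos_le_divide_eq) auto
      then have "p * ?z + q \<le> m" by (simp add: algebra_simps)
      also have "\<dots> \<le> payoff \<mu> ?z" unfolding m_def by (rule payoff_ge_mean[OF fin])
      finally show ?thesis by (intro exI[of _ ?z]) auto
    qed
    then obtain z where z: "z < x" "p * z + q \<le> payoff \<mu> z" by auto
    have "\<exists>u\<ge>z. u \<le> x \<and> payoff \<mu> u - (p * u + q) = 0"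
      using x z by (intro IVT2' continuous_intros continuous_on_payoff fin) auto
    then obtain u where u: "u < x" "payoff \<mu> u = p * u + q"
      using x by (auto simp: le_less)
    show ?thesis
      using max_payoff_line_spread[OF fin u(1) v(1) u(2) v(2) x] fin
      by (intro exI[of _ "bind_pmf \<mu> (spread u v)"]) auto
  qed
qed

text \<open>The lines are added one at a time. The maximum is stated as an upper bound that is
  attained, the form in which a Bellman equation uses it.\<close>

lemma ex_payoff_eq_Max_lines:
  assumes "finite L" "finite (set_pmf \<mu>)"
    "\<And>p q. (p, q) \<in> L \<Longrightarrow> 0 \<le> p \<and> p \<le> 1 \<and> (p < 1 \<or> q \<le> 0)"
  shows "\<exists>\<mu>'. finite (set_pmf \<mu>') \<and> (\<forall>y. payoff \<mu> y \<le> payoff \<mu>' y \<and>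
     (\<forall>(p, q)\<in>L. p * y + q \<le> payoff \<mu>' y) \<and>
     (payoff \<mu>' y = payoff \<mu> y \<or> (\<exists>(p, q)\<in>L. payoff \<mu>' y = p * y + q)))"
  using assms(1,3)
proof (induction L)
  case empty
  then show ?case using assms(2) by (intro exI[of _ \<mu>]) auto
next
  case (insert l L)
  obtain p q where l: "l = (p, q)" by (cases l)
  from insert.IH insert.prems obtain \<mu>1 where 1: "finite (set_pmf \<mu>1)" "\<And>y. payoff \<mu> y \<le> payoff \<mu>1 y"
     "\<And>y. \<forall>(p, q)\<in>L. p * y + q \<le> payoff \<mu>1 y"
     "\<And>y. payoff \<mu>1 y = payoff \<mu> y \<or> (\<exists>(p, q)\<in>L. payoff \<mu>1 y = p * y + q)"
    by (metis insertCI)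
  obtain \<mu>2 where 2: "finite (set_pmf \<mu>2)" "\<And>y. payoff \<mu>2 y = max (payoff \<mu>1 y) (p * y + q)"
    using ex_payoff_eq_max_line[OF 1(1), of p q] insert.prems[of p q] l by auto
  show ?case
  proof (intro exI[of _ \<mu>2] conjI allI 2(1))
    fix y
    show "payoff \<mu> y \<le> payoff \<mu>2 y" using 1(2)[of y] by (simp add: 2(2))
    show "\<forall>(p, q)\<in>insert l L. p * y + q \<le> payoff \<mu>2 y"
      using 1(3)[of y] by (auto simp: 2(2) l le_max_iff_disj)
    show "payoff \<mu>2 y = payoff \<mu> y \<or> (\<exists>(p, q)\<in>insert l L. payoff \<mu>2 y = p * y + q)"
      using 1(4)[of y] by (auto simp: 2(2) l max_def)
  qed
qed

text \<open>A payoff function is the maximum of finitely many lines, one for each guess of the set of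
  prizes that beat the outside option.\<close>

definition guess_lines :: "real pmf \<Rightarrow> real \<Rightarrow> (real \<times> real) set" where
  "guess_lines \<mu> c = (\<lambda>A. (measure_pmf.prob \<mu> (- A),
     measure_pmf.expectation \<mu> (\<lambda>v. if v \<in> A then v else 0) - c)) ` Pow (set_pmf \<mu>)"

text \<open>The line of a guess is the value of a fixed rule: pay \<open>c\<close>, take the prize
  if it lies in \<open>A\<close>, and the outside option otherwise. The slope is the probability of
  ending with the outside option.\<close>

lemma guess_line_eq:
  assumes "finite (set_pmf \<mu>)"
  shows "measure_pmf.prob \<mu> (- A) * y + (measure_pmf.expectation \<mu> (\<lambda>v. if v \<in> A then v else 0) - c)
    = measure_pmf.expectation \<mu> (\<lambda>v. if v \<in> A then v else y) - c"
proof -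
  have "measure_pmf.expectation \<mu> (\<lambda>v. if v \<in> A then v else y) =
     measure_pmf.expectation \<mu> (\<lambda>v. indicator (- A) v * y + (if v \<in> A then v else 0))"
    by (intro expectation_cong_pmf) auto
  also have "\<dots> = measure_pmf.prob \<mu> (- A) * y + measure_pmf.expectation \<mu> (\<lambda>v. if v \<in> A then v else 0)"
    by (simp add: expectation_add_finite assms)
  finally show ?thesis by simp
qed

lemma guess_lines_le:
  assumes "finite (set_pmf \<mu>)" "(p, q) \<in> guess_lines \<mu> c"
  shows "p * y + q \<le> payoff \<mu> y - c"
proof -
  obtain A where "p * y + q = measure_pmf.expectation \<mu> (\<lambda>v. if v \<in> A then v else y) - c"
    using assms guess_line_eq[OF assms(1)] by (auto simp: guess_lines_def)
  also have "\<dots> \<le> payoff \<mu> y - c"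
    unfolding payoff_def by (intro diff_right_mono expectation_mono_finite assms) auto
  finally show ?thesis .
qed

lemma guess_lines_attain:
  assumes "finite (set_pmf \<mu>)"
  shows "\<exists>(p, q)\<in>guess_lines \<mu> c. payoff \<mu> y - c = p * y + q"
proof -
  \<comment> \<open>The rule that is optimal for the given outside option.\<close>
  let ?A = "{v \<in> set_pmf \<mu>. y < v}"
  have "payoff \<mu> y = measure_pmf.expectation \<mu> (\<lambda>v. if v \<in> ?A then v else y)"
    unfolding payoff_def by (rule expectation_cong_pmf) auto
  then show ?thesis
    unfolding guess_lines_def using guess_line_eq[OF assms, of ?A y c]
    by (intro bexI[OF _ imageI[of ?A]]) auto
qed

text \<open>Slope 1 means that the prize is almost surely refused, which leaves the constant
  \<open>- c\<close>. Nonnegativity of costs thus makes the lines admissible for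
  \<open>ex_payoff_eq_max_line\<close>.\<close>

lemma guess_lines_slope:
  assumes "finite (set_pmf \<mu>)" "0 \<le> c" "(p, q) \<in> guess_lines \<mu> c"
  shows "0 \<le> p \<and> p \<le> 1 \<and> (p < 1 \<or> q \<le> 0)"
proof -
  obtain A where A: "p = measure_pmf.prob \<mu> (- A)"
     "q = measure_pmf.expectation \<mu> (\<lambda>v. if v \<in> A then v else 0) - c"
    using assms by (auto simp: guess_lines_def)
  have "q \<le> 0" if "p = 1"
  proof -
    have "AE v in \<mu>. v \<in> - A" using that A by (subst (asm) eq_commute) (simp add: measure_pmf.prob_eq_1)
    then have "measure_pmf.expectation \<mu> (\<lambda>v. if v \<in> A then v else 0) = measure_pmf.expectation \<mu> (\<lambda>v. 0)"
      by (intro expectation_cong_pmf) (auto simp: AE_measure_pmf_iff)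
    with A assms show ?thesis by simp
  qed
  moreover have "p \<le> 1" using A by simp
  ultimately show ?thesis using A by (auto simp: less_le)
qed

text \<open>One Bellman step, with \<open>\<nu> a\<close> the prize after action \<open>a\<close>:
  the class of payoff functions is closed under subtracting costs and maximising over actions and
  stopping, because all functions involved are maxima of admissible lines.\<close>

lemma ex_payoff_eq_Max_payoffs:
  assumes "finite A" "A \<noteq> {}" "\<And>a. a \<in> A \<Longrightarrow> finite (set_pmf (\<nu> a))"
    "\<And>a. a \<in> A \<Longrightarrow> 0 \<le> c a"
  shows "\<exists>\<mu>. finite (set_pmf \<mu>) \<and>
     (\<forall>y. (\<forall>a\<in>A. payoff (\<nu> a) y - c a \<le> payoff \<mu> y) \<and>
       (payoff \<mu> y = y \<or> (\<exists>a\<in>A. payoff \<mu> y = payoff (\<nu> a) y - c a)))"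
proof -
  obtain b where b: "b \<in> A" using assms by auto
  \<comment> \<open>The lines are added to the payoff of a point mass at \<open>q0\<close>. As
    \<open>q0\<close> never exceeds the value of action \<open>b\<close>, this start contributes
    only the outside option to the maximum.\<close>
  define q0 where "q0 = measure_pmf.expectation (\<nu> b) (\<lambda>v. v) - c b"
  define L where "L = (\<Union>a\<in>A. guess_lines (\<nu> a) (c a))"
  have fin: "finite L" using assms by (auto simp: L_def guess_lines_def)
  obtain \<mu> where \<mu>: "finite (set_pmf \<mu>)" "\<And>y. payoff (return_pmf q0) y \<le> payoff \<mu> y"
     "\<And>y p q. (p, q) \<in> L \<Longrightarrow> p * y + q \<le> payoff \<mu> y"
     "\<And>y. payoff \<mu> y = payoff (return_pmf q0) y \<or> (\<exists>(p, q)\<in>L. payoff \<mu> y = p * y + q)"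
  proof -
    have "0 \<le> p \<and> p \<le> 1 \<and> (p < 1 \<or> q \<le> 0)" if "(p, q) \<in> L" for p q
      using that assms(3,4) guess_lines_slope unfolding L_def by blast
    from ex_payoff_eq_Max_lines[OF fin, of "return_pmf q0", OF _ this] that show ?thesis
      by (simp del: payoff_return split: prod.splits)
  qed
  have up: "payoff (\<nu> a) y - c a \<le> payoff \<mu> y" if "a \<in> A" for a y
    using guess_lines_attain[OF assms(3)[OF that], of "c a" y] \<mu>(3) that
    by (force simp: L_def)
  have q0: "q0 \<le> payoff (\<nu> b) y - c b" for y
    using payoff_ge_mean[OF assms(3)[OF b], of y] by (simp add: q0_def)
  have "payoff \<mu> y = y \<or> (\<exists>a\<in>A. payoff \<mu> y = payoff (\<nu> a) y - c a)" for y
  proof -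
    consider "payoff \<mu> y = y" | "payoff \<mu> y = q0" |
      a p q where "a \<in> A" "(p, q) \<in> guess_lines (\<nu> a) (c a)" "payoff \<mu> y = p * y + q"
      using \<mu>(4)[of y] by (auto simp: L_def max_def split: if_splits)
    then show ?thesis
    proof cases
      case 2
      then have "payoff \<mu> y = payoff (\<nu> b) y - c b"
        using q0[of y] up[OF b, of y] by linarith
      with b show ?thesis by blast
    next
      case 3
      then have "payoff \<mu> y = payoff (\<nu> a) y - c a"
        using guess_lines_le[OF assms(3)[OF 3(1)] 3(2), of y] up[OF 3(1), of y] by linarith
      with 3 show ?thesis by blast
    qed simp
  qed
  with up \<mu>(1) show ?thesis by blast
qed

section \<open>Surrogate prizes of an MDP\<close>

text \<open>Collects the conditions on states, actions and costs, which pass to committed chains by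
  \<open>finite_acyclic_commit\<close>.\<close>

definition finite_acyclic_MDP :: "('s, 'a) cimdp \<Rightarrow> bool" where
  "finite_acyclic_MDP M \<longleftrightarrow>
     finite (states M) \<and> start M \<in> states M \<and> terminals M \<subseteq> states M \<and>
     (\<forall>s\<in>nonterminals M. finite (actions M s) \<and> actions M s \<noteq> {}) \<and>
     (\<forall>s\<in>nonterminals M. \<forall>a\<in>actions M s. 0 \<le> cost M a) \<and>
     (\<forall>s\<in>nonterminals M. \<forall>a\<in>actions M s. set_pmf (trans_pmf M s a) \<subseteq> states M) \<and>
     acyclic (step_rel M)"

lemma finite_acyclic_costly_information_MDP:
  "costly_information_MDP M \<Longrightarrow> finite_acyclic_MDP M"
  unfolding costly_information_MDP_def finite_acyclic_MDP_def by blast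

lemma finite_acyclic_MDP_D:
  assumes "finite_acyclic_MDP M"
  shows "finite (states M)" "start M \<in> states M" "terminals M \<subseteq> states M" "acyclic (step_rel M)"
    and "s \<in> nonterminals M \<Longrightarrow> finite (actions M s)" "s \<in> nonterminals M \<Longrightarrow> actions M s \<noteq> {}"
    and "s \<in> nonterminals M \<Longrightarrow> s \<in> states M" "s \<in> nonterminals M \<Longrightarrow> s \<notin> terminals M"
    and "s \<in> nonterminals M \<Longrightarrow> a \<in> actions M s \<Longrightarrow> 0 \<le> cost M a"
    and "s \<in> nonterminals M \<Longrightarrow> a \<in> actions M s \<Longrightarrow> s' \<in> set_pmf (trans_pmf M s a) \<Longrightarrow> s' \<in> states M"
    and "s \<in> nonterminals M \<Longrightarrow> a \<in> actions M s \<Longrightarrow> finite (set_pmf (trans_pmf M s a))"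
  using assms unfolding finite_acyclic_MDP_def nonterminals_def
  by (blast intro: finite_subset)+

lemma finite_step_rel:
  assumes "finite_acyclic_MDP M" shows "finite (step_rel M)"
proof (rule finite_subset)
  show "step_rel M \<subseteq> states M \<times> states M"
    using finite_acyclic_MDP_D[OF assms] by (auto simp: step_rel_def)
qed (use finite_acyclic_MDP_D[OF assms] in auto)

lemma wf_converse_step_rel:
  "finite_acyclic_MDP M \<Longrightarrow> wf ((step_rel M)\<inverse>)"
  by (simp add: finite_step_rel finite_acyclic_MDP_D finite_acyclic_wf_converse)

lemma commit_simps [simp]:
  "states (commit M \<pi>) = states M" "start (commit M \<pi>) = start M"
  "actions (commit M \<pi>) s = {s}" "terminals (commit M \<pi>) = terminals M"
  "nonterminals (commit M \<pi>) = nonterminals M" "val (commit M \<pi>) = val M"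
  by (auto simp: commit_def nonterminals_def val_def fun_eq_iff)

text \<open>Every step of the chain is a step of the MDP under some action in the support of the
  commitment, and its cost averages nonnegative costs.\<close>

lemma finite_acyclic_commit:
  assumes "finite_acyclic_MDP M" "commitment M \<pi>"
  shows "finite_acyclic_MDP (commit M \<pi>)"
proof -
  note D = finite_acyclic_MDP_D[OF assms(1)]
  have sub: "set_pmf (\<pi> s) \<subseteq> actions M s" if "s \<in> nonterminals M" for s
    using assms(2) that by (auto simp: commitment_def)
  have "step_rel (commit M \<pi>) \<subseteq> step_rel M"
    using sub by (fastforce simp: step_rel_def commit_def nonterminals_def)
  then have "acyclic (step_rel (commit M \<pi>))" using D(4) acyclic_subset by blast
  moreover have "0 \<le> cost (commit M \<pi>) s" if "s \<in> nonterminals M" for s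
    using sub[OF that] D(9)[OF that]
    by (auto simp: commit_def intro!: integral_nonneg_AE AE_pmfI)
  moreover have "set_pmf (trans_pmf (commit M \<pi>) s s) \<subseteq> states M" if "s \<in> nonterminals M" for s
    using sub[OF that] D(10)[OF that] by (auto simp: commit_def)
  ultimately show ?thesis using D(1-3) unfolding finite_acyclic_MDP_def by auto
qed

text \<open>The payoffs of a surrogate solve the Bellman equation of the local game for all outside
  options simultaneously.\<close>

definition surrogate :: "('s, 'a) cimdp \<Rightarrow> ('s \<Rightarrow> real pmf) \<Rightarrow> 's \<Rightarrow> real pmf \<Rightarrow> bool" where
  "surrogate M W s \<mu> \<longleftrightarrow> finite (set_pmf \<mu>) \<and>
     (s \<in> terminals M \<longrightarrow> \<mu> = return_pmf (val M s)) \<and>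
     (s \<in> nonterminals M \<longrightarrow> (\<forall>y.
        (\<forall>a\<in>actions M s. payoff (bind_pmf (trans_pmf M s a) W) y - cost M a \<le> payoff \<mu> y) \<and>
        (payoff \<mu> y = y \<or>
         (\<exists>a\<in>actions M s. payoff \<mu> y = payoff (bind_pmf (trans_pmf M s a) W) y - cost M a))))"

definition surrogates :: "('s, 'a) cimdp \<Rightarrow> ('s \<Rightarrow> real pmf) \<Rightarrow> bool" where
  "surrogates M W \<longleftrightarrow> (\<forall>s. s \<in> states M \<longrightarrow> surrogate M W s (W s))"

text \<open>Backward recursion from the terminal states: \<open>ex_payoff_eq_Max_payoffs\<close>
  turns the prizes of the successors into a prize of the state.\<close>

lemma ex_surrogates:
  assumes M: "finite_acyclic_MDP M"
  shows "\<exists>W. surrogates M W"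
  unfolding surrogates_def
proof (rule dependent_wf_choice[OF wf_converse_step_rel[OF M],
      where P = "\<lambda>W s \<mu>. s \<in> states M \<longrightarrow> surrogate M W s \<mu>"])
  fix W W' s \<mu>
  assume eq: "\<And>z. (z, s) \<in> (step_rel M)\<inverse> \<Longrightarrow> W z = (W' z :: real pmf)"
  \<comment> \<open>The condition on the prize of \<open>s\<close> reads \<open>W\<close> only at
    successors of \<open>s\<close>, as the recursion demands.\<close>
  have "bind_pmf (trans_pmf M s a) W = bind_pmf (trans_pmf M s a) W'"
    if "s \<in> nonterminals M" "a \<in> actions M s" for a
    by (rule bind_pmf_cong) (use eq that in \<open>auto simp: step_rel_def\<close>)
  then show "(s \<in> states M \<longrightarrow> surrogate M W s \<mu>) = (s \<in> states M \<longrightarrow> surrogate M W' s \<mu>)"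
    unfolding surrogate_def by auto
next
  note D = finite_acyclic_MDP_D[OF M]
  fix W s
  assume IH: "\<And>z. (z, s) \<in> (step_rel M)\<inverse> \<Longrightarrow> z \<in> states M \<longrightarrow> surrogate M W z (W z)"
  show "\<exists>\<mu>. s \<in> states M \<longrightarrow> surrogate M W s \<mu>"
  proof (cases "s \<in> nonterminals M")
    case True
    have "finite (set_pmf (W s'))" if "a \<in> actions M s" "s' \<in> set_pmf (trans_pmf M s a)" for a s'
      using IH[of s'] True that D(10)[OF True that] by (auto simp: step_rel_def surrogate_def)
    then have "finite (set_pmf (bind_pmf (trans_pmf M s a) W))" if "a \<in> actions M s" for a
      using that D(11)[OF True that] by auto
    from ex_payoff_eq_Max_payoffs[of "actions M s" "\<lambda>a. bind_pmf (trans_pmf M s a) W" "cost M",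
        OF D(5,6)[OF True] this D(9)[OF True]]
    show ?thesis using D(8)[OF True] True by (auto simp: surrogate_def)
  next
    case False
    then show ?thesis
      by (intro exI[of _ "return_pmf (val M s)"]) (auto simp: surrogate_def nonterminals_def)
  qed
qed

section \<open>Surrogate prizes and the local game\<close>

context
  fixes M :: "('s, 'a) cimdp" and W :: "'s \<Rightarrow> real pmf"
  assumes M: "finite_acyclic_MDP M" and W: "surrogates M W"
begin

lemma finite_surrogate: "s \<in> states M \<Longrightarrow> finite (set_pmf (W s))"
  using W by (auto simp: surrogates_def surrogate_def)

lemma surrogate_terminal: "s \<in> terminals M \<Longrightarrow> W s = return_pmf (val M s)"
  using W finite_acyclic_MDP_D(3)[OF M] by (auto simp: surrogates_def surrogate_def)

lemma finite_surrogate_successor: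
  assumes "s \<in> nonterminals M" "a \<in> actions M s"
  shows "finite (set_pmf (bind_pmf (trans_pmf M s a) W))"
  using assms finite_acyclic_MDP_D(10,11)[OF M assms] finite_surrogate by auto

lemma payoff_surrogate_successor:
  assumes "s \<in> nonterminals M" "a \<in> actions M s"
  shows "payoff (bind_pmf (trans_pmf M s a) W) y =
    measure_pmf.expectation (trans_pmf M s a) (\<lambda>s'. payoff (W s') y)"
  using assms finite_acyclic_MDP_D(10,11)[OF M assms] finite_surrogate by (intro payoff_bind) auto

lemma payoff_surrogate_ge:
  assumes "s \<in> nonterminals M" "a \<in> actions M s"
  shows "payoff (bind_pmf (trans_pmf M s a) W) y - cost M a \<le> payoff (W s) y"
  using assms W finite_acyclic_MDP_D(7)[OF M assms(1)] by (auto simp: surrogates_def surrogate_def)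

lemma payoff_surrogate_cases:
  assumes "s \<in> nonterminals M"
  obtains "payoff (W s) y = y"
    | a where "a \<in> actions M s" "payoff (W s) y = payoff (bind_pmf (trans_pmf M s a) W) y - cost M a"
  using assms W finite_acyclic_MDP_D(7)[OF M assms(1)]
  unfolding surrogates_def surrogate_def by blast

text \<open>Induction on the policy: by the Bellman inequality no first move is worth more than the
  surrogate payoff, and mixing moves does not help.\<close>

lemma local_utility_le_payoff:
  assumes "local_feasible M p s" "s \<in> states M"
  shows "local_utility M y p s \<le> payoff (W s) y"
  using assms
proof (induction p arbitrary: s)
  case Take_Outside
  then show ?case by (simp add: payoff_ge finite_surrogate)
next
  case Take_Terminal
  then show ?case by (simp add: surrogate_terminal)
next
  case (Local_Advance a k)
  then have s: "s \<in> nonterminals M" "a \<in> actions M s" by auto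
  have "measure_pmf.expectation (trans_pmf M s a) (\<lambda>s'. local_utility M y (k s') s') \<le>
      measure_pmf.expectation (trans_pmf M s a) (\<lambda>s'. payoff (W s') y)"
    using Local_Advance finite_acyclic_MDP_D(10,11)[OF M s]
    by (intro expectation_mono_finite) auto
  with payoff_surrogate_ge[OF s, of y] show ?case by (simp add: payoff_surrogate_successor[OF s])
next
  case (Local_Flip t p q)
  then have "local_utility M y p s \<le> payoff (W s) y" "local_utility M y q s \<le> payoff (W s) y"
    by auto
  with Local_Flip.prems show ?case
    by (auto intro!: convex_bound_le)
qed

text \<open>Backward induction along the transitions: an optimal policy makes the move that attains
  the maximum in the Bellman equation.\<close>

lemma ex_local_utility_eq_payoff:
  "s \<in> states M \<Longrightarrow> \<exists>p. local_feasible M p s \<and> local_utility M y p s = payoff (W s) y"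
proof (induction s rule: wf_induct_rule[OF wf_converse_step_rel[OF M]])
  case (1 s)
  show ?case
  proof (cases "s \<in> terminals M")
    case True
    then show ?thesis
      by (cases "y \<le> val M s")
        (auto simp: surrogate_terminal max_def intro: exI[of _ Take_Outside] exI[of _ Take_Terminal])
  next
    case False
    with 1 have s: "s \<in> nonterminals M" by (simp add: nonterminals_def)
    show ?thesis
    proof (cases rule: payoff_surrogate_cases[OF s, of y])
      case 1
      then show ?thesis by (intro exI[of _ Take_Outside]) simp
    next
      case (2 a)
      have "\<forall>s'\<in>set_pmf (trans_pmf M s a).
          \<exists>p. local_feasible M p s' \<and> local_utility M y p s' = payoff (W s') y"
        using 1 s 2(1) finite_acyclic_MDP_D(10)[OF M s 2(1)] by (auto simp: step_rel_def)
      then obtain k where k: "\<And>s'. s' \<in> set_pmf (trans_pmf M s a) \<Longrightarrow>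
          local_feasible M (k s') s' \<and> local_utility M y (k s') s' = payoff (W s') y"
        by metis
      then have "measure_pmf.expectation (trans_pmf M s a) (\<lambda>s'. local_utility M y (k s') s') =
          measure_pmf.expectation (trans_pmf M s a) (\<lambda>s'. payoff (W s') y)"
        by (intro expectation_cong_pmf) auto
      with k s 2 show ?thesis
        by (intro exI[of _ "Local_Advance a k"]) (auto simp: payoff_surrogate_successor[OF s])
    qed
  qed
qed

text \<open>One random prize, independent of \<open>y\<close>, represents the local optimum for all
  outside options.\<close>

lemma local_opt_eq_payoff: "local_opt M y = payoff (W (start M)) y"
proof -
  obtain p where p: "local_feasible M p (start M)" "local_utility M y p (start M) = payoff (W (start M)) y"
    using ex_local_utility_eq_payoff finite_acyclic_MDP_D(2)[OF M] by blast
  show ?thesis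
    unfolding local_opt_def
    by (rule cSup_eq_maximum)
      (use p local_utility_le_payoff finite_acyclic_MDP_D(2)[OF M] in \<open>auto intro!: rev_image_eqI[of p]\<close>)
qed

end

section \<open>Maximum weight extensions of an accepted set\<close>

text \<open>Stated for arbitrary set systems: besides the matroid, the subsystem
  \<open>{Y \<in> F. i \<notin> Y}\<close> of sets avoiding an element occurs.\<close>

definition extensions :: "'i set set \<Rightarrow> 'i set \<Rightarrow> 'i set set" where
  "extensions F X = {S. S \<inter> X = {} \<and> S \<union> X \<in> F}"

definition max_weight :: "'i set set \<Rightarrow> 'i set \<Rightarrow> ('i \<Rightarrow> real) \<Rightarrow> real" where
  "max_weight F X w = Max (sum w ` extensions F X)"

lemma finite_extensions:
  assumes "finite F" shows "finite (extensions F X)"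
proof (rule finite_imageD)
  show "finite ((\<lambda>S. S \<union> X) ` extensions F X)"
    using assms by (rule rev_finite_subset) (auto simp: extensions_def)
  show "inj_on (\<lambda>S. S \<union> X) (extensions F X)"
    by (rule inj_onI) (auto simp: extensions_def)
qed

lemma max_weight_ge:
  "finite F \<Longrightarrow> S \<in> extensions F X \<Longrightarrow> sum w S \<le> max_weight F X w"
  unfolding max_weight_def by (rule Max_ge) (auto simp: finite_extensions)

lemma empty_extension: "X \<in> F \<Longrightarrow> {} \<in> extensions F X"
  by (simp add: extensions_def)

lemma max_weight_attained:
  assumes "finite F" "X \<in> F"
  obtains S where "S \<in> extensions F X" "max_weight F X w = sum w S"
proof -
  have "max_weight F X w \<in> sum w ` extensions F X"
    unfolding max_weight_def using assms empty_extension[OF assms(2)]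
    by (intro Max_in) (auto simp: finite_extensions)
  then show ?thesis using that by auto
qed

lemma max_weight_nonneg:
  "finite F \<Longrightarrow> X \<in> F \<Longrightarrow> 0 \<le> max_weight F X w"
  using max_weight_ge[OF _ empty_extension, of F X w] by simp

text \<open>In a downward closed system every element of an extension is itself eligible, so only
  weights of eligible elements are counted.\<close>

lemma max_weight_cong:
  assumes "\<And>j. insert j X \<in> F \<Longrightarrow> j \<notin> X \<Longrightarrow> w j = w' j"
    and "\<And>Y Z. Z \<in> F \<Longrightarrow> Y \<subseteq> Z \<Longrightarrow> Y \<in> F"
  shows "max_weight F X w = max_weight F X w'"
  unfolding max_weight_def
proof (rule arg_cong[of _ _ Max], rule image_cong[OF refl], rule sum.cong[OF refl])
  fix S j assume S: "S \<in> extensions F X" "j \<in> S"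
  then have "insert j X \<in> F" using assms(2)[of "S \<union> X" "insert j X"] by (auto simp: extensions_def)
  with S show "w j = w' j" using assms(1)[of j] by (auto simp: extensions_def)
qed

lemma max_weight_scale:
  assumes "finite F" "X \<in> F" "0 \<le> c"
  shows "max_weight F X (\<lambda>j. c * w j) = c * max_weight F X w"
proof -
  have "sum (\<lambda>j. c * w j) ` extensions F X = (\<lambda>v. c * v) ` sum w ` extensions F X"
    by (auto simp: image_image sum_distrib_left)
  moreover have "extensions F X \<noteq> {}" using empty_extension[OF assms(2)] by blast
  ultimately show ?thesis
    unfolding max_weight_def
    using mono_Max_commute[of "\<lambda>v. c * v" "sum w ` extensions F X"] assms
    by (simp add: finite_extensions mono_def mult_left_mono)
qed

section \<open>Maximum weights in matroids\<close>

context
  fixes E :: "'i set" and F :: "'i set set"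
  assumes matroid: "matroid E F"
begin

lemma finite_independents: "finite F"
  using matroid unfolding matroid_def by (meson finite_Pow_iff finite_subset)

lemma independent_subset: "Y \<in> F \<Longrightarrow> X \<subseteq> Y \<Longrightarrow> X \<in> F"
  using matroid unfolding matroid_def by blast

lemma independent_in_ground: "Y \<in> F \<Longrightarrow> Y \<subseteq> E"
  using matroid unfolding matroid_def by blast

lemma eligible_in_ground: "insert j X \<in> F \<Longrightarrow> j \<in> E"
  using independent_in_ground by blast

lemma finite_independent: "Y \<in> F \<Longrightarrow> finite Y"
  using matroid independent_in_ground unfolding matroid_def by (meson finite_subset)

text \<open>The exchange axiom is iterated until the cardinalities agree.\<close>

lemma independent_augment:
  assumes "X \<in> F" "Y \<in> F" "card X \<le> card Y"
  shows "\<exists>T\<in>F. X \<subseteq> T \<and> T \<subseteq> X \<union> Y \<and> card T = card Y"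
  using assms
proof (induction "card Y - card X" arbitrary: X)
  case 0
  then show ?case by (intro bexI[of _ X]) auto
next
  case (Suc k)
  then have "card X < card Y" by simp
  then obtain e where e: "e \<in> Y - X" "insert e X \<in> F"
    using matroid Suc.prems unfolding matroid_def by blast
  have "card (insert e X) = Suc (card X)" using e finite_independent[OF Suc.prems(1)] by simp
  then have "\<exists>T\<in>F. insert e X \<subseteq> T \<and> T \<subseteq> insert e X \<union> Y \<and> card T = card Y"
    using Suc e by (intro Suc.hyps(1)) auto
  then show ?case using e by blast
qed

lemma max_weight_ineligible:
  assumes "i \<in> X \<or> insert i X \<notin> F"
  shows "max_weight F X (w(i := v)) = max_weight F X w"
  by (rule max_weight_cong) (use assms independent_subset in auto)

text \<open>Case distinction on an optimal extension: it avoids \<open>i\<close>, or removing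
  \<open>i\<close> leaves an extension of \<open>insert i X\<close>.\<close>

lemma max_weight_split:
  assumes "i \<notin> X" "insert i X \<in> F"
  shows "max_weight F X w =
    max (max_weight {Y \<in> F. i \<notin> Y} X w) (max_weight F (insert i X) w + w i)"
proof (rule antisym)
  let ?F = "{Y \<in> F. i \<notin> Y}"
  have fin: "finite F" "finite ?F" using finite_independents by auto
  have X: "X \<in> F" "X \<in> ?F" using assms independent_subset[of "insert i X" X] by auto
  obtain S where S: "S \<in> extensions F X" "max_weight F X w = sum w S"
    using max_weight_attained[OF fin(1) X(1)] .
  have finS: "finite S" using finite_independent[of "S \<union> X"] S by (auto simp: extensions_def)
  show "max_weight F X w \<le> max (max_weight ?F X w) (max_weight F (insert i X) w + w i)"
  proof (cases "i \<in> S")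
    case True
    then have "(S - {i}) \<union> insert i X = S \<union> X" by auto
    then have "S - {i} \<in> extensions F (insert i X)"
      using S by (auto simp: extensions_def simp del: Un_insert_right)
    from max_weight_ge[OF fin(1) this, of w] show ?thesis
      using S True finS by (simp add: sum_diff1)
  next
    case False
    then have "S \<in> extensions ?F X" using S assms by (auto simp: extensions_def)
    from max_weight_ge[OF fin(2) this, of w] show ?thesis using S by simp
  qed
  have "max_weight ?F X w \<le> max_weight F X w"
  proof (rule max_weight_attained[OF fin(2) X(2), of w])
    fix S assume "S \<in> extensions ?F X" "max_weight ?F X w = sum w S"
    then show ?thesis using max_weight_ge[OF fin(1), of S X w] by (auto simp: extensions_def)
  qed
  moreover have "max_weight F (insert i X) w + w i \<le> max_weight F X w"
  proof (rule max_weight_attained[OF fin(1) assms(2), of w])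
    fix S assume S: "S \<in> extensions F (insert i X)" "max_weight F (insert i X) w = sum w S"
    then have "finite S" "i \<notin> S" "insert i S \<in> extensions F X"
      using finite_independent[of "S \<union> insert i X"] assms(1) by (auto simp: extensions_def)
    with max_weight_ge[OF fin(1) this(3), of w] S show ?thesis by simp
  qed
  ultimately show "max (max_weight ?F X w) (max_weight F (insert i X) w + w i) \<le> max_weight F X w"
    by simp
qed

text \<open>Neither of the two maxima in \<open>max_weight_split\<close> counts the weight of
  \<open>i\<close>. As a function of \<open>v\<close> the result is therefore an outcome of the
  local game with a constant outside option.\<close>

lemma max_weight_update:
  assumes "i \<notin> X" "insert i X \<in> F"
  shows "max_weight F X (w(i := v)) = max_weight F (insert i X) w +
    max (max_weight {Y \<in> F. i \<notin> Y} X w - max_weight F (insert i X) w) v"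
proof -
  have "max_weight {Y \<in> F. i \<notin> Y} X (w(i := v)) = max_weight {Y \<in> F. i \<notin> Y} X w"
    by (rule max_weight_cong) (use independent_subset in auto)
  moreover have "max_weight F (insert i X) (w(i := v)) = max_weight F (insert i X) w"
    by (rule max_weight_ineligible) simp
  ultimately show ?thesis using max_weight_split[OF assms, of "w(i := v)"] by simp
qed

text \<open>Exchange: a best extension avoiding \<open>i\<close> loses at most one element to make room for \<open>i\<close>.\<close>

lemma max_weight_exchange:
  assumes "i \<notin> X" "insert i X \<in> F" "0 \<le> \<tau>"
    and le: "\<And>j. j \<noteq> i \<Longrightarrow> j \<notin> X \<Longrightarrow> insert j X \<in> F \<Longrightarrow> w j \<le> \<tau>"
  shows "max_weight {Y \<in> F. i \<notin> Y} X w - max_weight F (insert i X) w \<le> \<tau>"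
proof -
  let ?F = "{Y \<in> F. i \<notin> Y}"
  have fin: "finite F" "finite ?F" using finite_independents by auto
  have X: "X \<in> F" "X \<in> ?F" using assms independent_subset[of "insert i X" X] by auto
  have finX: "finite X" by (rule finite_independent[OF X(1)])
  obtain S where S: "S \<in> extensions ?F X" "max_weight ?F X w = sum w S"
    using max_weight_attained[OF fin(2) X(2)] .
  then have SX: "S \<inter> X = {}" "S \<union> X \<in> F" "i \<notin> S" by (auto simp: extensions_def)
  have finS: "finite S" using finite_independent[OF SX(2)] by simp
  show ?thesis
  proof (cases "S = {}")
    case True
    with S max_weight_nonneg[OF fin(1) assms(2), of w] assms(3) show ?thesis by simp
  next
    case False
    then have "card S \<ge> 1" using finS by (simp add: Suc_le_eq card_gt_0_iff)
    moreover have card: "card (S \<union> X) = card S + card X" by (simp add: card_Un_disjoint finS finX SX)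
    ultimately have "card (insert i X) \<le> card (S \<union> X)" using assms(1) finX by simp
    then obtain T where T: "T \<in> F" "insert i X \<subseteq> T" "T \<subseteq> insert i X \<union> (S \<union> X)" "card T = card (S \<union> X)"
      using independent_augment[OF assms(2) SX(2)] by blast
    define S' where "S' = T - insert i X"
    have sub: "S' \<subseteq> S" using T by (auto simp: S'_def)
    have "card S' = card T - card (insert i X)"
      unfolding S'_def using T finX by (intro card_Diff_subset) auto
    then have "card (S - S') = 1"
      using T(4) card assms(1) finX finS sub \<open>card S \<ge> 1\<close> by (simp add: card_Diff_subset finite_subset)
    \<comment> \<open>\<open>T\<close> arises from \<open>insert i X\<close> by adding elements of
      \<open>S\<close> and has the size of \<open>S \<union> X\<close>, so exactly one element
      \<open>j\<close> of \<open>S\<close> is given up for \<open>i\<close>.\<close>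
    then obtain j where j: "S - S' = {j}" by (auto simp: card_1_singleton_iff)
    have "S' \<union> insert i X = T" using T by (auto simp: S'_def)
    then have "S' \<in> extensions F (insert i X)"
      using T by (auto simp: extensions_def S'_def simp del: Un_insert_right)
    then have "sum w S' \<le> max_weight F (insert i X) w" by (rule max_weight_ge[OF fin(1)])
    moreover have "sum w S = sum w S' + w j"
      using sum.subset_diff[OF sub finS, of w] j by simp
    moreover have "w j \<le> \<tau>"
    proof (rule le)
      have "j \<in> S" using j by auto
      then show "j \<noteq> i" "j \<notin> X" "insert j X \<in> F"
        using SX independent_subset[OF SX(2), of "insert j X"] by auto
    qed
    ultimately show ?thesis using S by simp
  qed
qed

lemma max_weight_nonpos:
  assumes "X \<in> F" "\<And>j. j \<notin> X \<Longrightarrow> insert j X \<in> F \<Longrightarrow> w j \<le> 0"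
  shows "max_weight F X w \<le> 0"
proof (rule max_weight_attained[OF finite_independents assms(1), of w])
  fix S assume S: "S \<in> extensions F X" "max_weight F X w = sum w S"
  have "sum w S \<le> 0"
  proof (rule sum_nonpos)
    fix j assume "j \<in> S"
    with S(1) show "w j \<le> 0"
      using independent_subset[of "S \<union> X" "insert j X"] by (intro assms(2)) (auto simp: extensions_def)
  qed
  with S show ?thesis by simp
qed

section \<open>Expected maximum weights\<close>

text \<open>The product distribution makes the prizes independent. The default 0 is the weight
  outside the ground set, where no extension counts it.\<close>

definition exp_max_weight :: "'i set \<Rightarrow> ('i \<Rightarrow> real pmf) \<Rightarrow> real" where
  "exp_max_weight X \<nu> = measure_pmf.expectation (Pi_pmf E 0 \<nu>) (max_weight F X)"

lemma finite_ground: "finite E"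
  using matroid by (simp add: matroid_def)

lemma exp_max_weight_cong:
  assumes "\<And>j. j \<in> E \<Longrightarrow> \<nu> j = \<nu>' j"
  shows "exp_max_weight X \<nu> = exp_max_weight X \<nu>'"
  unfolding exp_max_weight_def using Pi_pmf_cong[of E E 0 0 \<nu> \<nu>'] assms by simp

lemma finite_set_Pi_pmf:
  assumes "finite A" "\<And>j. j \<in> A \<Longrightarrow> finite (set_pmf (\<nu> j))"
  shows "finite (set_pmf (Pi_pmf A 0 \<nu>))"
  using assms by (simp add: set_Pi_pmf finite_PiE_dflt)

text \<open>Revealing the prize of \<open>i\<close> last turns the problem into a local game.\<close>

lemma exp_max_weight_reveal:
  assumes i: "i \<in> E" and fin: "\<And>j. j \<in> E \<Longrightarrow> j \<noteq> i \<Longrightarrow> finite (set_pmf (\<nu> j))" "finite (set_pmf \<mu>)"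
  shows "exp_max_weight X (\<nu>(i := \<mu>)) =
    measure_pmf.expectation (Pi_pmf (E - {i}) 0 \<nu>)
      (\<lambda>w. measure_pmf.expectation \<mu> (\<lambda>v. max_weight F X (w(i := v))))"
proof -
  have Pi: "Pi_pmf (E - {i}) 0 (\<nu>(i := \<mu>)) = Pi_pmf (E - {i}) 0 \<nu>"
    by (rule Pi_pmf_cong) auto
  have "Pi_pmf E 0 (\<nu>(i := \<mu>)) =
      bind_pmf \<mu> (\<lambda>v. bind_pmf (Pi_pmf (E - {i}) 0 \<nu>) (\<lambda>w. return_pmf (w(i := v))))"
    using Pi_pmf_insert'[of "E - {i}" i 0 "\<nu>(i := \<mu>)"] finite_ground i
    by (simp add: insert_absorb Pi)
  also have "\<dots> = bind_pmf (Pi_pmf (E - {i}) 0 \<nu>) (\<lambda>w. bind_pmf \<mu> (\<lambda>v. return_pmf (w(i := v))))"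
    by (rule bind_commute_pmf)
  finally have eq: "Pi_pmf E 0 (\<nu>(i := \<mu>)) = \<dots>" .
  have "finite (set_pmf (Pi_pmf (E - {i}) 0 \<nu>))"
    using fin finite_ground by (intro finite_set_Pi_pmf) auto
  then show ?thesis
    unfolding exp_max_weight_def eq using fin(2) by (simp add: expectation_bind_finite)
qed

text \<open>The dependence on \<open>\<mu>\<close> is only through an average of
  \<open>payoff \<mu>\<close> at random outside options determined by the other prizes. Comparisons
  of payoff functions thereby become comparisons of potentials.\<close>

lemma exp_max_weight_eligible:
  assumes "i \<notin> X" "insert i X \<in> F"
    and "\<And>j. j \<in> E \<Longrightarrow> j \<noteq> i \<Longrightarrow> finite (set_pmf (\<nu> j))" "finite (set_pmf \<mu>)"
  shows "exp_max_weight X (\<nu>(i := \<mu>)) =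
    measure_pmf.expectation (Pi_pmf (E - {i}) 0 \<nu>)
      (\<lambda>w. max_weight F (insert i X) w +
        payoff \<mu> (max_weight {Y \<in> F. i \<notin> Y} X w - max_weight F (insert i X) w))"
  using exp_max_weight_reveal[OF eligible_in_ground[OF assms(2)] assms(3,4)]
  by (simp add: max_weight_update[OF assms(1,2)] expectation_add_finite[OF assms(4)] payoff_def)

lemma exp_max_weight_ineligible:
  assumes "i \<in> E" "i \<in> X \<or> insert i X \<notin> F"
    and "\<And>j. j \<in> E \<Longrightarrow> j \<noteq> i \<Longrightarrow> finite (set_pmf (\<nu> j))" "finite (set_pmf \<mu>)"
  shows "exp_max_weight X (\<nu>(i := \<mu>)) =
    measure_pmf.expectation (Pi_pmf (E - {i}) 0 \<nu>) (max_weight F X)"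
  using exp_max_weight_reveal[OF assms(1,3,4)] by (simp add: max_weight_ineligible[OF assms(2)])

text \<open>For eligible \<open>i\<close> the payoff inequality is averaged over the random outside
  option; otherwise the prize of \<open>i\<close> has no effect and \<open>0 \<le> c\<close>
  decides.\<close>

lemma exp_max_weight_mono:
  assumes "i \<in> E" and \<nu>: "\<And>j. j \<in> E \<Longrightarrow> j \<noteq> i \<Longrightarrow> finite (set_pmf (\<nu> j))"
    and fin: "finite (set_pmf \<mu>)" "finite (set_pmf \<mu>')"
    and le: "\<And>y. payoff \<mu> y - c \<le> payoff \<mu>' y" "0 \<le> c"
  shows "exp_max_weight X (\<nu>(i := \<mu>)) - c \<le> exp_max_weight X (\<nu>(i := \<mu>'))"
proof (cases "i \<notin> X \<and> insert i X \<in> F")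
  case True
  have finPi: "finite (set_pmf (Pi_pmf (E - {i}) 0 \<nu>))"
    using \<nu> finite_ground by (intro finite_set_Pi_pmf) auto
  have "exp_max_weight X (\<nu>(i := \<mu>)) - c =
    measure_pmf.expectation (Pi_pmf (E - {i}) 0 \<nu>)
      (\<lambda>w. max_weight F (insert i X) w +
        payoff \<mu> (max_weight {Y \<in> F. i \<notin> Y} X w - max_weight F (insert i X) w) - c)"
    using True \<nu> fin finPi by (simp add: exp_max_weight_eligible expectation_diff_finite)
  also have "\<dots> \<le> exp_max_weight X (\<nu>(i := \<mu>'))"
    using True \<nu> fin le(1) finPi
    by (simp add: exp_max_weight_eligible, intro expectation_mono_finite)
       (auto simp: diff_le_eq add.assoc intro: add_left_mono)
  finally show ?thesis .
next
  case False
  then have "i \<in> X \<or> insert i X \<notin> F" by auto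
  with assms show ?thesis by (simp add: exp_max_weight_ineligible)
qed

text \<open>The expected weight is linear in the distribution of each single prize; the two
  expectations are finite sums and commute.\<close>

lemma exp_max_weight_bind:
  assumes "i \<in> E" and \<nu>: "\<And>j. j \<in> E \<Longrightarrow> j \<noteq> i \<Longrightarrow> finite (set_pmf (\<nu> j))"
    and fin: "finite (set_pmf p)" "\<And>s. s \<in> set_pmf p \<Longrightarrow> finite (set_pmf (f s))"
  shows "exp_max_weight X (\<nu>(i := bind_pmf p f)) =
    measure_pmf.expectation p (\<lambda>s. exp_max_weight X (\<nu>(i := f s)))"
proof -
  define Q where "Q = Pi_pmf (E - {i}) 0 \<nu>"
  have finQ: "finite (set_pmf Q)"
    unfolding Q_def using \<nu> finite_ground by (intro finite_set_Pi_pmf) auto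
  let ?h = "\<lambda>w s. measure_pmf.expectation (f s) (\<lambda>v. max_weight F X (w(i := v)))"
  have "exp_max_weight X (\<nu>(i := bind_pmf p f)) =
      measure_pmf.expectation Q (\<lambda>w. measure_pmf.expectation p (?h w))"
    using assms by (simp add: exp_max_weight_reveal expectation_bind_finite Q_def)
  also have "\<dots> = measure_pmf.expectation p (\<lambda>s. measure_pmf.expectation Q (\<lambda>w. ?h w s))"
    using finQ fin(1)
    by (simp add: integral_measure_pmf[of "set_pmf Q"] integral_measure_pmf[of "set_pmf p"]
        sum_distrib_left sum.swap[of _ "set_pmf Q"] mult.left_commute)
  also have "\<dots> = measure_pmf.expectation p (\<lambda>s. exp_max_weight X (\<nu>(i := f s)))"
    using assms by (intro expectation_cong_pmf) (simp add: exp_max_weight_reveal Q_def)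
  finally show ?thesis .
qed

text \<open>Prizes are exchanged one at a time, each by \<open>exp_max_weight_mono\<close> at cost
  0. The set \<open>A\<close> of exchanged indices carries the induction.\<close>

lemma exp_max_weight_dominates:
  assumes "A \<subseteq> E" and fin: "\<And>j. j \<in> E \<Longrightarrow> finite (set_pmf (\<nu> j))" "\<And>j. j \<in> E \<Longrightarrow> finite (set_pmf (\<nu>' j))"
    and le: "\<And>j y. j \<in> E \<Longrightarrow> payoff (\<nu> j) y \<le> payoff (\<nu>' j) y"
  shows "exp_max_weight X \<nu> \<le> exp_max_weight X (\<lambda>j. if j \<in> A then \<nu>' j else \<nu> j)"
proof -
  have "finite A" using assms(1) finite_ground by (rule finite_subset)
  then show ?thesis using assms(1)
  proof (induction A)
    case (insert i A)
    let ?\<nu> = "\<lambda>j. if j \<in> A then \<nu>' j else \<nu> j"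
    have "exp_max_weight X (?\<nu>(i := \<nu> i)) - 0 \<le> exp_max_weight X (?\<nu>(i := \<nu>' i))"
      using insert.prems fin le by (intro exp_max_weight_mono) auto
    moreover have "?\<nu>(i := \<nu> i) = ?\<nu>" using insert.hyps by auto
    moreover have "?\<nu>(i := \<nu>' i) = (\<lambda>j. if j \<in> insert i A then \<nu>' j else \<nu> j)" by auto
    ultimately show ?case using insert by simp
  qed simp
qed

text \<open>Scaling commutes with the product distribution since it fixes the default 0, and with
  the maximum since \<open>c\<close> is nonnegative.\<close>

lemma exp_max_weight_scale:
  assumes "X \<in> F" "0 \<le> c"
  shows "exp_max_weight X (\<lambda>j. map_pmf (\<lambda>v. c * v) (\<nu> j)) = c * exp_max_weight X \<nu>"
  unfolding exp_max_weight_def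
  using finite_ground max_weight_scale[OF finite_independents assms]
  by (simp add: Pi_pmf_map[where f = "\<lambda>v. c * v" and dflt = 0] comp_def)

lemma set_Pi_pmf_D: "w \<in> set_pmf (Pi_pmf E 0 \<nu>) \<Longrightarrow> j \<in> E \<Longrightarrow> w j \<in> set_pmf (\<nu> j)"
  by (auto simp: set_Pi_pmf finite_ground PiE_dflt_def)

lemma exp_max_weight_nonneg: "X \<in> F \<Longrightarrow> 0 \<le> exp_max_weight X \<nu>"
  unfolding exp_max_weight_def by (simp add: max_weight_nonneg finite_independents)

lemma exp_max_weight_nonpos:
  assumes "X \<in> F" "\<And>j. j \<in> E \<Longrightarrow> finite (set_pmf (\<nu> j))"
    and "\<And>j v. j \<notin> X \<Longrightarrow> insert j X \<in> F \<Longrightarrow> v \<in> set_pmf (\<nu> j) \<Longrightarrow> v \<le> 0"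
  shows "exp_max_weight X \<nu> \<le> 0"
proof -
  have "max_weight F X w \<le> 0" if "w \<in> set_pmf (Pi_pmf E 0 \<nu>)" for w
    using assms(1,3) set_Pi_pmf_D[OF that] eligible_in_ground by (intro max_weight_nonpos) auto
  then show ?thesis
    using expectation_mono_finite[of "Pi_pmf E 0 \<nu>" "max_weight F X" "\<lambda>_. 0"] assms(2)
    by (simp add: exp_max_weight_def finite_set_Pi_pmf finite_ground)
qed

lemma exp_max_weight_accept_le:
  assumes "i \<notin> X" "insert i X \<in> F" "\<And>j. j \<in> E \<Longrightarrow> finite (set_pmf (\<nu> j))" "\<nu> i = return_pmf v"
  shows "v + exp_max_weight (insert i X) \<nu> \<le> exp_max_weight X \<nu>"
proof -
  have fin: "finite (set_pmf (Pi_pmf E 0 \<nu>))" using assms(3) by (intro finite_set_Pi_pmf finite_ground)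
  have "v + max_weight F (insert i X) w \<le> max_weight F X w" if "w \<in> set_pmf (Pi_pmf E 0 \<nu>)" for w
    using max_weight_split[OF assms(1,2), of w] set_Pi_pmf_D[OF that eligible_in_ground[OF assms(2)]] assms(4)
    by simp
  then have "measure_pmf.expectation (Pi_pmf E 0 \<nu>) (\<lambda>w. v + max_weight F (insert i X) w) \<le>
      exp_max_weight X \<nu>"
    unfolding exp_max_weight_def by (intro expectation_mono_finite fin)
  then show ?thesis by (simp add: exp_max_weight_def expectation_add_finite[OF fin])
qed

text \<open>By exchange, including \<open>i\<close> loses nothing if its sure prize is at least
  every other eligible prize.\<close>

lemma exp_max_weight_accept_ge:
  assumes "i \<notin> X" "insert i X \<in> F" "\<And>j. j \<in> E \<Longrightarrow> finite (set_pmf (\<nu> j))"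
    and "\<nu> i = return_pmf v" "0 \<le> v"
    and le: "\<And>j u. j \<noteq> i \<Longrightarrow> j \<notin> X \<Longrightarrow> insert j X \<in> F \<Longrightarrow> u \<in> set_pmf (\<nu> j) \<Longrightarrow> u \<le> v"
  shows "exp_max_weight X \<nu> \<le> v + exp_max_weight (insert i X) \<nu>"
proof -
  have fin: "finite (set_pmf (Pi_pmf E 0 \<nu>))" using assms(3) by (intro finite_set_Pi_pmf finite_ground)
  have "max_weight F X w \<le> v + max_weight F (insert i X) w" if "w \<in> set_pmf (Pi_pmf E 0 \<nu>)" for w
  proof -
    have "max_weight {Y \<in> F. i \<notin> Y} X w - max_weight F (insert i X) w \<le> v"
      using set_Pi_pmf_D[OF that] eligible_in_ground
      by (intro max_weight_exchange assms(1,2,5)) (auto intro!: le)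
    moreover have "w i = v"
      using set_Pi_pmf_D[OF that eligible_in_ground[OF assms(2)]] assms(4) by simp
    ultimately show ?thesis using max_weight_split[OF assms(1,2), of w] by simp
  qed
  then have "exp_max_weight X \<nu> \<le>
      measure_pmf.expectation (Pi_pmf E 0 \<nu>) (\<lambda>w. v + max_weight F (insert i X) w)"
    unfolding exp_max_weight_def by (intro expectation_mono_finite fin)
  then show ?thesis by (simp add: exp_max_weight_def expectation_add_finite[OF fin])
qed

text \<open>Exchange bounds the random outside option by \<open>\<tau>\<close>, so the payoffs need
  to be compared only up to \<open>\<tau>\<close>.\<close>

lemma exp_max_weight_advance:
  assumes i: "i \<notin> X" "insert i X \<in> F" and \<nu>: "\<And>j. j \<in> E \<Longrightarrow> finite (set_pmf (\<nu> j))"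
    and fin: "finite (set_pmf \<mu>)" "finite (set_pmf \<mu>')" and "0 \<le> \<tau>"
    and le: "\<And>j u. j \<noteq> i \<Longrightarrow> j \<notin> X \<Longrightarrow> insert j X \<in> F \<Longrightarrow> u \<in> set_pmf (\<nu> j) \<Longrightarrow> u \<le> \<tau>"
    and payoff: "\<And>y. y \<le> \<tau> \<Longrightarrow> payoff \<mu> y \<le> payoff \<mu>' y - c"
  shows "exp_max_weight X (\<nu>(i := \<mu>)) \<le> exp_max_weight X (\<nu>(i := \<mu>')) - c"
proof -
  define Q where "Q = Pi_pmf (E - {i}) 0 \<nu>"
  have finQ: "finite (set_pmf Q)"
    unfolding Q_def using \<nu> finite_ground by (intro finite_set_Pi_pmf) auto
  let ?B = "max_weight F (insert i X)"
  let ?y = "\<lambda>w. max_weight {Y \<in> F. i \<notin> Y} X w - ?B w"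
  have "?y w \<le> \<tau>" if "w \<in> set_pmf Q" for w
  proof (intro max_weight_exchange i \<open>0 \<le> \<tau>\<close>)
    fix j assume j: "j \<noteq> i" "j \<notin> X" "insert j X \<in> F"
    then have "w j \<in> set_pmf (\<nu> j)"
      using that eligible_in_ground[OF j(3)] finite_ground
      by (auto simp: Q_def set_Pi_pmf PiE_dflt_def)
    with j show "w j \<le> \<tau>" by (rule le)
  qed
  then have "measure_pmf.expectation Q (\<lambda>w. ?B w + payoff \<mu> (?y w)) \<le>
      measure_pmf.expectation Q (\<lambda>w. ?B w + payoff \<mu>' (?y w) - c)"
    using payoff by (intro expectation_mono_finite finQ) (simp add: add.assoc flip: add_diff_eq)
  then show ?thesis
    using i \<nu> fin by (simp add: exp_max_weight_eligible expectation_diff_finite[OF finQ] flip: Q_def)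
qed

end

section \<open>Policies and surrogate prizes\<close>

declare One_nat_def [simp del] atLeastAtMost_iff [simp del]

text \<open>Each index is accepted at most once and costs are nonnegative. The bound makes the
  suprema in \<open>OPT\<close> and \<open>CG\<close> those of bounded sets.\<close>

lemma feasible_utility_le_sum_abs_val:
  assumes "\<And>i. i \<in> {1..n} \<Longrightarrow> finite_acyclic_MDP (M i)"
  shows "feasible n M F p x X \<Longrightarrow> utility M p x \<le> (\<Sum>i\<in>{1..n} - X. \<Sum>s\<in>states (M i). \<bar>val (M i) s\<bar>)"
proof (induction p arbitrary: x X)
  case Stop
  show ?case by (simp add: sum_nonneg)
next
  case (Accept i p)
  let ?B = "\<lambda>i. \<Sum>s\<in>states (M i). \<bar>val (M i) s\<bar>"
  have i: "i \<in> {1..n}" "i \<notin> X" "x i \<in> terminals (M i)" using Accept.prems by auto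
  note D = finite_acyclic_MDP_D[OF assms[OF i(1)]]
  have "val (M i) (x i) \<le> ?B i"
    using member_le_sum[of "x i" "states (M i)" "\<lambda>s. \<bar>val (M i) s\<bar>"] D(1,3) i by fastforce
  moreover have "utility M p x \<le> sum ?B ({1..n} - insert i X)" using Accept by auto
  moreover have "sum ?B ({1..n} - X) = ?B i + sum ?B ({1..n} - X - {i})"
    using i by (intro sum.remove) auto
  moreover have "{1..n} - X - {i} = {1..n} - insert i X" by auto
  ultimately show ?case by simp
next
  case (Advance i a k)
  let ?B = "\<Sum>i\<in>{1..n} - X. \<Sum>s\<in>states (M i). \<bar>val (M i) s\<bar>"
  have i: "i \<in> {1..n}" "x i \<in> nonterminals (M i)" "a \<in> actions (M i) (x i)" using Advance.prems by auto
  note D = finite_acyclic_MDP_D[OF assms[OF i(1)]]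
  have "measure_pmf.expectation (trans_pmf (M i) (x i) a) (\<lambda>s'. utility M (k s') (x(i := s'))) \<le>
      measure_pmf.expectation (trans_pmf (M i) (x i) a) (\<lambda>_. ?B)"
    using Advance.prems D(11)[OF i(2,3)] by (intro expectation_mono_finite Advance.IH) (auto simp: fun_upd_def)
  with D(9)[OF i(2,3)] show ?case by simp
next
  case (Flip t p q)
  then have "utility M p x \<le> (\<Sum>i\<in>{1..n} - X. \<Sum>s\<in>states (M i). \<bar>val (M i) s\<bar>)"
    "utility M q x \<le> (\<Sum>i\<in>{1..n} - X. \<Sum>s\<in>states (M i). \<bar>val (M i) s\<bar>)" by auto
  with Flip.prems show ?case by (auto simp: atLeastAtMost_iff intro!: convex_bound_le)
qed

lemma bdd_above_utility:
  assumes "\<And>i. i \<in> {1..n} \<Longrightarrow> finite_acyclic_MDP (M i)"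
  shows "bdd_above ((\<lambda>p. utility M p x) ` {p. feasible n M F p x X})"
  using feasible_utility_le_sum_abs_val[OF assms] by (intro bdd_aboveI2) auto

lemma OPT_le:
  assumes "\<And>p. feasible n M F p (\<lambda>i. start (M i)) {} \<Longrightarrow> utility M p (\<lambda>i. start (M i)) \<le> B"
  shows "OPT n M F \<le> B"
  unfolding OPT_def
proof (rule cSUP_least)
  have "Stop \<in> {p. feasible n M F p (\<lambda>i. start (M i)) {}}" by simp
  then show "{p. feasible n M F p (\<lambda>i. start (M i)) {}} \<noteq> {}" by blast
qed (use assms in auto)

lemma OPT_ge:
  assumes "\<And>i. i \<in> {1..n} \<Longrightarrow> finite_acyclic_MDP (M i)"
    and "feasible n M F p (\<lambda>i. start (M i)) {}"
  shows "utility M p (\<lambda>i. start (M i)) \<le> OPT n M F"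
  unfolding OPT_def
  by (rule cSUP_upper) (use assms(2) bdd_above_utility[of n M, OF assms(1)] in auto)

section \<open>The potential bounds every policy and is attained by chains\<close>

context
  fixes n :: nat and M :: "nat \<Rightarrow> ('s, 'a) cimdp" and F :: "nat set set"
    and W :: "nat \<Rightarrow> 's \<Rightarrow> real pmf"
  assumes F: "matroid {1..n} F"
    and M: "\<And>i. i \<in> {1..n} \<Longrightarrow> finite_acyclic_MDP (M i)"
    and W: "\<And>i. i \<in> {1..n} \<Longrightarrow> surrogates (M i) (W i)"
begin

abbreviation potential :: "nat set \<Rightarrow> (nat \<Rightarrow> 's) \<Rightarrow> real" where
  "potential X x \<equiv> exp_max_weight {1..n} F X (\<lambda>i. W i (x i))"

lemma surrogate_vector_update: "(\<lambda>j. W j ((x(i := s)) j)) = (\<lambda>j. W j (x j))(i := W i s)"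
  by auto

lemma potential_bind:
  assumes i: "i \<in> {1..n}" "x i \<in> nonterminals (M i)" "a \<in> actions (M i) (x i)"
    and x: "\<And>i. i \<in> {1..n} \<Longrightarrow> x i \<in> states (M i)"
  shows "measure_pmf.expectation (trans_pmf (M i) (x i) a) (\<lambda>s'. potential X (x(i := s'))) =
    exp_max_weight {1..n} F X ((\<lambda>j. W j (x j))(i := bind_pmf (trans_pmf (M i) (x i) a) (W i)))"
  unfolding surrogate_vector_update
  by (subst exp_max_weight_bind[OF F i(1)])
    (use x finite_surrogate[OF M W] finite_acyclic_MDP_D(10,11)[OF M[OF i(1)] i(2,3)] i in auto)

text \<open>The potential plus the net gain so far is a supermartingale: accepting is covered by
  \<open>exp_max_weight_accept_le\<close>, advancing by the Bellman inequality and
  \<open>exp_max_weight_mono\<close>.\<close>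

lemma utility_le_potential:
  assumes "feasible n M F p x X" "X \<in> F" "\<And>i. i \<in> {1..n} \<Longrightarrow> x i \<in> states (M i)"
  shows "utility M p x \<le> potential X x"
  using assms
proof (induction p arbitrary: x X)
  case Stop
  then show ?case by (simp add: exp_max_weight_nonneg[OF F])
next
  case (Accept i p)
  then have i: "i \<in> {1..n}" "i \<notin> X" "insert i X \<in> F" "x i \<in> terminals (M i)" by auto
  have "val (M i) (x i) + potential (insert i X) x \<le> potential X x"
    by (intro exp_max_weight_accept_le[OF F i(2,3)])
      (use Accept.prems(3) finite_surrogate[OF M W] surrogate_terminal[OF M W] i in auto)
  moreover have "utility M p x \<le> potential (insert i X) x" using Accept i by auto
  ultimately show ?case by simp
next
  case (Advance i a k)
  then have i: "i \<in> {1..n}" "x i \<in> nonterminals (M i)" "a \<in> actions (M i) (x i)" by auto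
  note D = finite_acyclic_MDP_D[OF M[OF i(1)]]
  let ?D = "trans_pmf (M i) (x i) a"
  have "measure_pmf.expectation ?D (\<lambda>s'. utility M (k s') (x(i := s'))) \<le>
      measure_pmf.expectation ?D (\<lambda>s'. potential X (x(i := s')))"
  proof (rule expectation_mono_finite[OF D(11)[OF i(2,3)]])
    fix s' assume s': "s' \<in> set_pmf ?D"
    then show "utility M (k s') (x(i := s')) \<le> potential X (x(i := s'))"
      using Advance.prems D(10)[OF i(2,3) s'] by (intro Advance.IH) (auto simp: fun_upd_def)
  qed
  also have "\<dots> = exp_max_weight {1..n} F X ((\<lambda>j. W j (x j))(i := bind_pmf ?D (W i)))"
    using i Advance.prems(3) by (intro potential_bind) auto
  also have "\<dots> - cost (M i) a \<le> exp_max_weight {1..n} F X ((\<lambda>j. W j (x j))(i := W i (x i)))"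
    using i D(9)[OF i(2,3)] Advance.prems(3) finite_surrogate[OF M W]
      payoff_surrogate_ge[OF M W] finite_surrogate_successor[OF M W]
    by (intro exp_max_weight_mono[OF F]) auto
  also have "(\<lambda>j. W j (x j))(i := W i (x i)) = (\<lambda>j. W j (x j))" by auto
  finally show ?case by (simp add: fun_upd_def)
next
  case (Flip t p q)
  then have "utility M p x \<le> potential X x" "utility M q x \<le> potential X x" by auto
  with Flip.prems show ?case by (auto simp: atLeastAtMost_iff intro!: convex_bound_le)
qed

lemma OPT_le_potential: "OPT n M F \<le> potential {} (\<lambda>i. start (M i))"
  using F finite_acyclic_MDP_D(2)[OF M]
  by (intro OPT_le utility_le_potential) (auto simp: matroid_def)

text \<open>Below the largest prize stopping is strictly suboptimal, so the maximum in the Bellman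
  equation is attained by the only action of the chain.\<close>

lemma payoff_surrogate_chain:
  assumes i: "i \<in> {1..n}" and s: "s \<in> nonterminals (M i)" "actions (M i) s = {a}"
    and y: "y \<le> Max (set_pmf (W i s))"
  shows "payoff (W i s) y \<le> payoff (bind_pmf (trans_pmf (M i) s a) (W i)) y - cost (M i) a"
proof -
  let ?\<tau> = "Max (set_pmf (W i s))"
  let ?g = "\<lambda>y. payoff (bind_pmf (trans_pmf (M i) s a) (W i)) y - cost (M i) a"
  have fin: "finite (set_pmf (W i s))"
    using finite_surrogate[OF M W] finite_acyclic_MDP_D(7)[OF M s(1)] i by auto
  have fin': "finite (set_pmf (bind_pmf (trans_pmf (M i) s a) (W i)))"
    by (rule finite_surrogate_successor[OF M[OF i] W[OF i] s(1)]) (simp add: s)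
  have \<tau>: "?\<tau> \<in> set_pmf (W i s)" using fin by (intro Max_in) (auto simp: set_pmf_not_empty)
  have less: "payoff (W i s) y \<le> ?g y" if "y < ?\<tau>" for y
    using payoff_surrogate_cases[OF M[OF i] W[OF i] s(1), of y] payoff_gt[OF fin \<tau> that] s(2)
    by fastforce
  \<comment> \<open>Continuity extends the inequality to \<open>y = ?\<tau>\<close>, which is
    required because exchange yields only a weak bound on the outside option.\<close>
  have "continuous_on {..?\<tau>} (\<lambda>y. payoff (W i s) y - ?g y)"
    by (intro continuous_intros continuous_on_payoff fin fin')
  then have "closed ({..?\<tau>} \<inter> (\<lambda>y. payoff (W i s) y - ?g y) -` {..0})"
    by (rule continuous_closed_preimage) auto
  moreover have "{..<?\<tau>} \<subseteq> {..?\<tau>} \<inter> (\<lambda>y. payoff (W i s) y - ?g y) -` {..0}"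
    using less by auto
  ultimately have "closure {..<?\<tau>} \<subseteq> {..?\<tau>} \<inter> (\<lambda>y. payoff (W i s) y - ?g y) -` {..0}"
    by (metis closure_minimal)
  then have "y \<in> (\<lambda>y. payoff (W i s) y - ?g y) -` {..0}" using y by auto
  then show ?thesis by simp
qed

text \<open>Termination measure for the greedy policy: states still ahead in each chain plus indices
  not yet accepted.\<close>

definition remaining_steps :: "nat set \<Rightarrow> (nat \<Rightarrow> 's) \<Rightarrow> nat" where
  "remaining_steps X x = (\<Sum>i\<in>{1..n}. card ((step_rel (M i))\<^sup>+ `` {x i})) + (n - card X)"

lemma remaining_steps_accept:
  assumes "i \<notin> X" "insert i X \<in> F"
  shows "remaining_steps (insert i X) x < remaining_steps X x"
proof -
  have sub: "insert i X \<subseteq> {1..n}" by (rule independent_in_ground[OF F assms(2)])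
  then have "card (insert i X) \<le> n" using card_mono[OF _ sub] by simp
  moreover have "finite X" using sub finite_subset[OF sub] by simp
  ultimately show ?thesis using assms(1) by (simp add: remaining_steps_def)
qed

text \<open>All states ahead of \<open>s'\<close> are ahead of \<open>x i\<close>, while
  \<open>s'\<close> itself drops out by acyclicity.\<close>

lemma remaining_steps_advance:
  assumes i: "i \<in> {1..n}" and step: "(x i, s') \<in> step_rel (M i)"
  shows "remaining_steps X (x(i := s')) < remaining_steps X x"
proof -
  let ?R = "\<lambda>i s. (step_rel (M i))\<^sup>+ `` {s}"
  have "?R i s' \<subset> ?R i (x i)"
  proof
    show "?R i s' \<subseteq> ?R i (x i)" using step by (auto intro: trancl_into_trancl2)
    have "s' \<in> ?R i (x i)" "s' \<notin> ?R i s'"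
      using step finite_acyclic_MDP_D(4)[OF M[OF i]] by (auto simp: acyclic_def)
    then show "?R i s' \<noteq> ?R i (x i)" by blast
  qed
  moreover have "finite (?R i (x i))"
    using finite_step_rel[OF M[OF i]] by (intro finite_Image) simp
  ultimately have "card (?R i s') < card (?R i (x i))" by (intro psubset_card_mono)
  then have "(\<Sum>j\<in>{1..n}. card (?R j ((x(i := s')) j))) < (\<Sum>j\<in>{1..n}. card (?R j (x j)))"
    using i by (intro sum_strict_mono_ex1) auto
  then show ?thesis by (simp add: remaining_steps_def)
qed

text \<open>The greedy index policy: always move the eligible chain with the largest possible
  surrogate prize.\<close>

lemma ex_utility_ge_potential:
  assumes chain: "\<And>i s. i \<in> {1..n} \<Longrightarrow> s \<in> nonterminals (M i) \<Longrightarrow> \<exists>a. actions (M i) s = {a}"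
    and "X \<in> F" "\<And>i. i \<in> {1..n} \<Longrightarrow> x i \<in> states (M i)"
  shows "\<exists>p. feasible n M F p x X \<and> potential X x \<le> utility M p x"
  using assms(2,3)
proof (induction "remaining_steps X x" arbitrary: X x rule: less_induct)
  case less
  define \<tau> where "\<tau> j = Max (set_pmf (W j (x j)))" for j
  have fin: "finite (set_pmf (W j (x j)))" if "j \<in> {1..n}" for j
    using finite_surrogate[OF M W] that less.prems by auto
  define C where "C = {j. j \<notin> X \<and> insert j X \<in> F}"
  have C: "C \<subseteq> {1..n}" using independent_in_ground[OF F] by (auto simp: C_def)
  have le_\<tau>: "v \<le> \<tau> j" if "j \<in> C" "v \<in> set_pmf (W j (x j))" for j v
    unfolding \<tau>_def using that C fin by (intro Max_ge) auto
  show ?case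
  proof (cases "\<forall>j\<in>C. \<tau> j \<le> 0")
    case True
    \<comment> \<open>Without a positive eligible prize the empty extension is optimal, and stopping
      attains the potential.\<close>
    have "potential X x \<le> 0"
      using fin le_\<tau> True
      by (intro exp_max_weight_nonpos[OF F less.prems(1)]) (fastforce simp: C_def)+
    then show ?thesis by (intro exI[of _ Stop]) simp
  next
    case False
    have finC: "finite C" using C finite_subset by blast
    moreover have "C \<noteq> {}" using False by auto
    ultimately obtain i where i: "i \<in> C" "\<And>j. j \<in> C \<Longrightarrow> \<tau> j \<le> \<tau> i"
      using Max_in[of "\<tau> ` C"] Max_ge[of "\<tau> ` C"] by fastforce
    then have \<tau>: "0 \<le> \<tau> i" using False by fastforce
    have iX: "i \<notin> X" "insert i X \<in> F" and i1: "i \<in> {1..n}" using i(1) C by (auto simp: C_def)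
    have top: "u \<le> \<tau> i" if "j \<noteq> i" "j \<notin> X" "insert j X \<in> F" "u \<in> set_pmf (W j (x j))" for j u
      using le_\<tau>[of j u] i(2)[of j] that by (simp add: C_def)
    note D = finite_acyclic_MDP_D[OF M[OF i1]]
    show ?thesis
    proof (cases "x i \<in> terminals (M i)")
      case True
      have Wi: "W i (x i) = return_pmf (val (M i) (x i))" by (rule surrogate_terminal[OF M[OF i1] W[OF i1] True])
      then have "\<tau> i = val (M i) (x i)" by (simp add: \<tau>_def)
      \<comment> \<open>A terminal state has a sure prize, which is here the largest one possible,
        so accepting keeps the potential.\<close>
      with top \<tau> have "potential X x \<le> val (M i) (x i) + potential (insert i X) x"
        by (intro exp_max_weight_accept_ge[where \<nu> = "\<lambda>j. W j (x j)", OF F iX fin Wi]) auto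
      moreover obtain p where "feasible n M F p x (insert i X)" "potential (insert i X) x \<le> utility M p x"
        using less.hyps[OF remaining_steps_accept[OF iX] iX(2)] less.prems by blast
      ultimately show ?thesis using True iX i1 by (intro exI[of _ "Accept i p"]) auto
    next
      case False
      then have s: "x i \<in> nonterminals (M i)" using less.prems(2)[OF i1] by (simp add: nonterminals_def)
      obtain a where a: "actions (M i) (x i) = {a}" using chain[OF i1 s] by blast
      let ?D = "trans_pmf (M i) (x i) a"
      have "\<exists>p. feasible n M F p (x(i := s')) X \<and> potential X (x(i := s')) \<le> utility M p (x(i := s'))"
        if "s' \<in> set_pmf ?D" for s'
      proof (rule less.hyps)
        show "remaining_steps X (x(i := s')) < remaining_steps X x"
          using i1 s a that by (intro remaining_steps_advance) (auto simp: step_rel_def)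
      qed (use less.prems D(10)[OF s _ that] a in auto)
      then obtain k where k: "\<And>s'. s' \<in> set_pmf ?D \<Longrightarrow>
          feasible n M F (k s') (x(i := s')) X \<and> potential X (x(i := s')) \<le> utility M (k s') (x(i := s'))"
        by metis
      have "(\<lambda>j. W j (x j)) = (\<lambda>j. W j (x j))(i := W i (x i))" by auto
      then have "potential X x = exp_max_weight {1..n} F X ((\<lambda>j. W j (x j))(i := W i (x i)))"
        by (rule arg_cong)
      \<comment> \<open>All other eligible prizes are at most \<open>\<tau> i\<close>, and up to
        this outside option \<open>payoff_surrogate_chain\<close> shows that advancing is
        optimal.\<close>
      also have "\<dots> \<le> exp_max_weight {1..n} F X ((\<lambda>j. W j (x j))(i := bind_pmf ?D (W i))) - cost (M i) a"
        using fin top \<tau> i1 a payoff_surrogate_chain[OF i1 s a]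
          finite_surrogate_successor[OF M[OF i1] W[OF i1] s, of a]
        by (intro exp_max_weight_advance[OF F iX, where \<tau> = "\<tau> i"]) (auto simp: \<tau>_def)
      also have "exp_max_weight {1..n} F X ((\<lambda>j. W j (x j))(i := bind_pmf ?D (W i))) =
          measure_pmf.expectation ?D (\<lambda>s'. potential X (x(i := s')))"
        using i1 s a less.prems by (intro potential_bind[symmetric]) auto
      also have "\<dots> \<le> measure_pmf.expectation ?D (\<lambda>s'. utility M (k s') (x(i := s')))"
        using k D(11)[OF s] a by (intro expectation_mono_finite) auto
      finally show ?thesis using k i1 s a by (intro exI[of _ "Advance i a k"]) auto
    qed
  qed
qed

lemma potential_le_OPT:
  assumes "\<And>i s. i \<in> {1..n} \<Longrightarrow> s \<in> nonterminals (M i) \<Longrightarrow> \<exists>a. actions (M i) s = {a}"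
  shows "potential {} (\<lambda>i. start (M i)) \<le> OPT n M F"
proof -
  have "{} \<in> F" using F by (simp add: matroid_def)
  from ex_utility_ge_potential[OF assms this, of "\<lambda>i. start (M i)"]
  obtain p where "feasible n M F p (\<lambda>i. start (M i)) {}"
    "potential {} (\<lambda>i. start (M i)) \<le> utility M p (\<lambda>i. start (M i))"
    using finite_acyclic_MDP_D(2)[OF M] by auto
  then show ?thesis using OPT_ge[of n M, OF M] by fastforce
qed

end

section \<open>Comparison with the committed instance\<close>

lemma payoff_scale:
  assumes "0 < c"
  shows "payoff (map_pmf (\<lambda>v. c * v) \<mu>) (c * y) = c * payoff \<mu> y"
  using assms by (simp add: payoff_def max_mult_distrib_left flip: integral_mult_right_zero)

lemma OPT_commit_ge:
  fixes M :: "nat \<Rightarrow> ('s, 'a) cimdp"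
  assumes \<alpha>: "0 < \<alpha>" and I: "matroid_max_CICS n M F"
    and P: "\<And>i. i \<in> {1..n} \<Longrightarrow> local_approximation \<alpha> (M i) (P i)"
  shows "\<alpha> * OPT n M F \<le> OPT n (\<lambda>i. commit (M i) (P i)) F"
proof -
  let ?N = "\<lambda>i. commit (M i) (P i)"
  have F: "matroid {1..n} F" and M: "\<And>i. i \<in> {1..n} \<Longrightarrow> finite_acyclic_MDP (M i)"
    using I by (auto simp: matroid_max_CICS_def finite_acyclic_costly_information_MDP)
  have N: "finite_acyclic_MDP (?N i)" if "i \<in> {1..n}" for i
    using M[OF that] P[OF that] by (auto simp: local_approximation_def intro: finite_acyclic_commit)
  obtain W where W: "\<And>i. i \<in> {1..n} \<Longrightarrow> surrogates (M i) (W i)"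
    using ex_surrogates[OF M] by metis
  obtain V where V: "\<And>i. i \<in> {1..n} \<Longrightarrow> surrogates (?N i) (V i)"
    using ex_surrogates[OF N] by metis
  define w where "w i = W i (start (M i))" for i
  define v where "v i = V i (start (?N i))" for i
  have fin: "finite (set_pmf (w i))" "finite (set_pmf (v i))" if "i \<in> {1..n}" for i
    using that finite_surrogate[OF M W] finite_surrogate[OF N V]
      finite_acyclic_MDP_D(2)[OF M] finite_acyclic_MDP_D(2)[OF N]
    by (auto simp: w_def v_def simp del: commit_simps)
  have le: "payoff (map_pmf (\<lambda>u. \<alpha> * u) (w i)) y \<le> payoff (v i) y" if i: "i \<in> {1..n}" for i y
  proof -
    \<comment> \<open>The outside option is written as \<open>\<alpha> * (y / \<alpha>)\<close> to
      match the local approximation condition.\<close>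
    have "payoff (map_pmf (\<lambda>u. \<alpha> * u) (w i)) (\<alpha> * (y / \<alpha>)) = \<alpha> * local_opt (M i) (y / \<alpha>)"
      unfolding payoff_scale[OF \<alpha>] w_def local_opt_eq_payoff[OF M[OF i] W[OF i]] ..
    also have "\<dots> \<le> local_opt (?N i) (\<alpha> * (y / \<alpha>))"
      using P[OF i] unfolding local_approximation_def by blast
    also have "\<dots> = payoff (v i) (\<alpha> * (y / \<alpha>))"
      unfolding v_def local_opt_eq_payoff[OF N[OF i] V[OF i]] ..
    finally show ?thesis using \<alpha> by simp
  qed
  have "\<alpha> * OPT n M F \<le> \<alpha> * exp_max_weight {1..n} F {} w"
    using OPT_le_potential[of n F M W, OF F M W] \<alpha> by (simp add: w_def[abs_def] mult_left_mono)
  also have "\<dots> = exp_max_weight {1..n} F {} (\<lambda>i. map_pmf (\<lambda>u. \<alpha> * u) (w i))"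
    using F \<alpha> by (intro exp_max_weight_scale[OF F, symmetric]) (auto simp: matroid_def)
  also have "\<dots> \<le> exp_max_weight {1..n} F {}
      (\<lambda>i. if i \<in> {1..n} then v i else map_pmf (\<lambda>u. \<alpha> * u) (w i))"
    using fin le by (intro exp_max_weight_dominates[OF F]) auto
  also have "\<dots> = exp_max_weight {1..n} F {} v"
    by (rule exp_max_weight_cong[OF F]) simp
  also have "\<dots> \<le> OPT n ?N F"
    using potential_le_OPT[of n F ?N V, OF F N V] by (simp add: v_def[abs_def])
  finally show ?thesis .
qed

text \<open>Committing keeps the values of the states, so the bound on the utility is uniform in the
  commitments.\<close>

lemma bdd_above_CG:
  fixes M :: "nat \<Rightarrow> ('s, 'a) cimdp"
  assumes M: "\<And>i. i \<in> {1..n} \<Longrightarrow> finite_acyclic_MDP (M i)" and "0 < OPT n M F"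
  shows "bdd_above ((\<lambda>P. OPT n (\<lambda>i. commit (M i) (P i)) F / OPT n M F) `
    {P. \<forall>i\<in>{1..n}. commitment (M i) (P i)})"
proof (rule bdd_aboveI2)
  fix P assume P: "P \<in> {P. \<forall>i\<in>{1..n}. commitment (M i) (P i)}"
  have N: "finite_acyclic_MDP (commit (M i) (P i))" if "i \<in> {1..n}" for i
    using M[OF that] P that by (auto intro: finite_acyclic_commit)
  have "OPT n (\<lambda>i. commit (M i) (P i)) F \<le> (\<Sum>i\<in>{1..n}. \<Sum>s\<in>states (M i). \<bar>val (M i) s\<bar>)"
    using feasible_utility_le_sum_abs_val[of n "\<lambda>i. commit (M i) (P i)" F _ _ "{}", OF N]
    by (intro OPT_le) auto
  then show "OPT n (\<lambda>i. commit (M i) (P i)) F / OPT n M F \<le>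
      (\<Sum>i\<in>{1..n}. \<Sum>s\<in>states (M i). \<bar>val (M i) s\<bar>) / OPT n M F"
    using assms(2) by (simp add: divide_right_mono)
qed

theorem theorem13:
  fixes \<alpha> :: real and n :: nat and M :: "nat \<Rightarrow> ('s, 'a) cimdp" and F :: "nat set set"
  assumes "0 < \<alpha>" and "\<alpha> \<le> 1"
    and "matroid_max_CICS n M F"
    and "\<And>i. i \<in> {1..n} \<Longrightarrow> \<exists>\<pi>. local_approximation \<alpha> (M i) \<pi>"
  shows "CG n M F \<ge> \<alpha>"
proof -
  have M: "\<And>i. i \<in> {1..n} \<Longrightarrow> finite_acyclic_MDP (M i)"
    using assms(3) by (auto simp: matroid_max_CICS_def finite_acyclic_costly_information_MDP)
  obtain P where P: "\<And>i. i \<in> {1..n} \<Longrightarrow> local_approximation \<alpha> (M i) (P i)"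
    using assms(4) by metis
  then have comm: "P \<in> {P. \<forall>i\<in>{1..n}. commitment (M i) (P i)}"
    by (auto simp: local_approximation_def)
  show ?thesis
  proof (cases "OPT n M F = 0")
    case True
    have "CG n M F = 1"
      unfolding CG_def using True comm by (auto intro: cSUP_const)
    with assms(2) show ?thesis by simp
  next
    case False
    \<comment> \<open>Stopping at once has utility 0, so a nonzero optimum is positive and may be
      divided by.\<close>
    moreover have "0 \<le> OPT n M F" using OPT_ge[of n M F Stop, OF M] by simp
    ultimately have pos: "0 < OPT n M F" by simp
    have "\<alpha> \<le> OPT n (\<lambda>i. commit (M i) (P i)) F / OPT n M F"
      using OPT_commit_ge[OF assms(1,3) P] pos by (simp add: pos_le_divide_eq)
    also have "\<dots> \<le> CG n M F"
      unfolding CG_def using False cSUP_upper[OF comm bdd_above_CG[of n M, OF M pos]] by simp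
    finally show ?thesis .
  qed
qed

end
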